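(* Suppose that the inducing points are uniformly sampled from the sample points (interior from interior, boundary from boundary, as in the context), and that there is a constant $C_0>0$ such that $\operatorname{trace}(\mathcal{K}(\boldsymbol{\psi}^{\boldsymbol{x}},\boldsymbol{\psi}^{\boldsymbol{x}}))\leq C_0$ for $\boldsymbol{x}\in\overline{\boldsymbol{x}}$. Let $\mathcal{E}(\mathcal{H}_a)$ be as in the context. With a probability at least $1-\delta$, $\delta\in(0,1)$, for any $\boldsymbol{r}=(r_1,r_2)\in\{1,\dots,R_1\}\times\{1,\dots,R_2\}$, there exists a constant $C$ such that $$\mathcal{E}(\mathcal{H}_a)\leq\max\bigg\{\frac{CN_\Omega^2\ln^2(2/\delta)}{\lambda_{r_1}M_\Omega},\ \frac{CN_{\partial\Omega}^2\ln^2(2/\delta)}{\tau_{r_2}M_{\partial\Omega}}\bigg\}+4\lambda_{r_1+1}+4\tau_{r_2+1},$$ with the convention that $\lambda_{R_1+1}=0$ and $\tau_{R_2+1}=0$.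
   Context: Space. $\Omega\subset\mathbb{R}^d$ is a bounded open domain with boundary $\partial\Omega$. $\mathcal{U}$ is a Banach space of real functions on $\overline{\Omega}$ with dual $\mathcal{U}^*$ and duality pairing $[\cdot,\cdot]$. There is a linear bijection $\mathcal{K}:\mathcal{U}^*\to\mathcal{U}$ that is symmetric ($[\phi,\mathcal{K}\varphi]=[\varphi,\mathcal{K}\phi]$) and positive ($[\phi,\mathcal{K}\phi]>0$ for $\phi\neq0$), and $\|u\|_{\mathcal{U}}^2=[\mathcal{K}^{-1}u,u]$. For vectors of functionals $\boldsymbol{\alpha}=(\alpha_i)$, $\boldsymbol{\beta}=(\beta_j)$ in $\mathcal{U}^*$, $\mathcal{K}\boldsymbol{\alpha}$ is the vector of functions $(\mathcal{K}\alpha_i)_i$ and $\mathcal{K}(\boldsymbol{\alpha},\boldsymbol{\beta})$ is the matrix with entries $[\alpha_i,\mathcal{K}\beta_j]$. Functionals. $1\leq D_b\leq D$; $L_1,\dots,L_{D_b}:\mathcal{U}\to C(\partial\Omega)$ and $L_{D_b+1},\dots,L_D:\mathcal{U}\to C(\Omega)$ are bounded linear operators; $\delta_{\boldsymbol{x}}$ is evaluation at $\boldsymbol{x}$. The $N$ sample points are $\overline{\boldsymbol{x}}=(\overline{\boldsymbol{x}}_1,\overline{\boldsymbol{x}}_2)$, with $\overline{\boldsymbol{x}}_1$ consisting of $N_\Omega$ points of $\Omega$ and $\overline{\boldsymbol{x}}_2$ of $N_{\partial\Omega}=N-N_\Omega$ points of $\partial\Omega$. For $\boldsymbol{x}\in\overline{\boldsymbol{x}}_1$,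 $\boldsymbol{\psi}^{\boldsymbol{x}}=(\delta_{\boldsymbol{x}}\circ L_i)_{D_b+1\leq i\leq D}$; for $\boldsymbol{x}\in\overline{\boldsymbol{x}}_2$, $\boldsymbol{\psi}^{\boldsymbol{x}}=(\delta_{\boldsymbol{x}}\circ L_i)_{1\leq i\leq D_b}$. $\boldsymbol{\psi}_\Omega$ (length $R_1=N_\Omega(D-D_b)$) collects the functionals of $\boldsymbol{\psi}^{\boldsymbol{x}}$, $\boldsymbol{x}\in\overline{\boldsymbol{x}}_1$; $\boldsymbol{\psi}_{\partial\Omega}$ (length $R_2=(N-N_\Omega)D_b$) collects those of $\boldsymbol{\psi}^{\boldsymbol{x}}$, $\boldsymbol{x}\in\overline{\boldsymbol{x}}_2$; $\boldsymbol{\psi}=(\boldsymbol{\psi}_\Omega,\boldsymbol{\psi}_{\partial\Omega})$. $\{\lambda_j\}_{j=1}^{R_1}$ and $\{\tau_j\}_{j=1}^{R_2}$ are the eigenvalues of $\mathcal{K}(\boldsymbol{\psi}_\Omega,\boldsymbol{\psi}_\Omega)$ and $\mathcal{K}(\boldsymbol{\psi}_{\partial\Omega},\boldsymbol{\psi}_{\partial\Omega})$, respectively, in descending order. Inducing points. $\widehat{\boldsymbol{x}}=(\widehat{\boldsymbol{x}}_1,\widehat{\boldsymbol{x}}_2)$, where $\widehat{\boldsymbol{x}}_1$ ($M_\Omega$ points) and $\widehat{\boldsymbol{x}}_2$ ($M_{\partial\Omega}$ points) are uniformly sampled from $\overline{\boldsymbol{x}}_1$ and $\overline{\boldsymbol{x}}_2$,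 separately. $\boldsymbol{\phi}$ is the vector of all functionals $\delta_{\boldsymbol{x}}\circ L_i$ with ($\boldsymbol{x}$ in $\widehat{\boldsymbol{x}}_1$, $D_b+1\leq i\leq D$) or ($\boldsymbol{x}$ in $\widehat{\boldsymbol{x}}_2$, $1\leq i\leq D_b$). Error. $\mathcal{H}_a=\operatorname{span}\{\mathcal{K}\boldsymbol{\phi}\}$, $\mathcal{H}_b=\{\boldsymbol{\beta}^T\mathcal{K}\boldsymbol{\psi}:|\boldsymbol{\beta}|\leq1\}$ with $|\cdot|$ the Euclidean norm, and $\mathcal{E}(\mathcal{H}_a)=\max_{h\in\mathcal{H}_b}\min_{v\in\mathcal{H}_a}\|v-h\|_{\mathcal{U}}^2$. *)

theory Defs
  imports
    "HOL-Analysis.Analysis"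
    "HOL-Probability.Probability"
    "HOL-Computational_Algebra.Computational_Algebra"
    "Jordan_Normal_Form.Char_Poly"
begin

text \<open>
  A Banach space of real functions on a set \<open>S\<close> is a type \<open>'u::banach\<close> with an evaluation map
  \<open>val u x\<close> (the value of \<open>u\<close> at \<open>x\<close>) that is linear in \<open>u\<close> and separates the elements of
  the space. Evaluation at a point is not required to be continuous.
\<close>

definition function_space_on :: "'a set \<Rightarrow> ('u::banach \<Rightarrow> 'a \<Rightarrow> real) \<Rightarrow> bool" where
  "function_space_on S val \<longleftrightarrow>
     (\<forall>x\<in>S. linear (\<lambda>u. val u x)) \<and>
     (\<forall>u v. (\<forall>x\<in>S. val u x = val v x) \<longrightarrow> u = v)"

text \<open>
  The dual of \<open>'u\<close> is the type \<open>'u \<Rightarrow>\<^sub>L real\<close>, and the duality pairing of \<open>\<phi>\<close> and \<open>u\<close> is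
  \<open>blinfun_apply \<phi> u\<close>.
\<close>

definition covariance_operator :: "(('u::banach \<Rightarrow>\<^sub>L real) \<Rightarrow> 'u) \<Rightarrow> bool" where
  "covariance_operator K \<longleftrightarrow>
     linear K \<and> bij K \<and>
     (\<forall>\<phi> \<psi>. blinfun_apply \<phi> (K \<psi>) = blinfun_apply \<psi> (K \<phi>)) \<and>
     (\<forall>\<phi>. \<phi> \<noteq> 0 \<longrightarrow> blinfun_apply \<phi> (K \<phi>) > 0) \<and>
     (\<forall>u. (norm u)\<^sup>2 = blinfun_apply (inv_into UNIV K u) u)"

text \<open>
  Bounded linear operators into \<open>C(S)\<close> with the supremum norm. Only the values of \<open>T u\<close> on \<open>S\<close>
  matter. For open \<open>S\<close>, boundedness in the supremum norm makes every \<open>T u\<close> bounded on \<open>S\<close>.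
\<close>

definition bounded_operator_into_C ::
    "'a::topological_space set \<Rightarrow> ('u::banach \<Rightarrow> 'a \<Rightarrow> real) \<Rightarrow> bool" where
  "bounded_operator_into_C S T \<longleftrightarrow>
     (\<forall>x\<in>S. linear (\<lambda>u. T u x)) \<and>
     (\<forall>u. continuous_on S (T u)) \<and>
     (\<exists>B. \<forall>u. \<forall>x\<in>S. \<bar>T u x\<bar> \<le> B * norm u)"

definition gp_setting ::
    "(real^'d) set \<Rightarrow> ('u::banach \<Rightarrow> real^'d \<Rightarrow> real) \<Rightarrow> (('u \<Rightarrow>\<^sub>L real) \<Rightarrow> 'u) \<Rightarrow>
     nat \<Rightarrow> nat \<Rightarrow> (nat \<Rightarrow> 'u \<Rightarrow> real^'d \<Rightarrow> real) \<Rightarrow> bool" where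
  "gp_setting \<Omega> val K Db D L \<longleftrightarrow>
     open \<Omega> \<and> bounded \<Omega> \<and>
     function_space_on (closure \<Omega>) val \<and>
     covariance_operator K \<and>
     1 \<le> Db \<and> Db \<le> D \<and>
     (\<forall>i\<in>{1..Db}. bounded_operator_into_C (frontier \<Omega>) (L i)) \<and>
     (\<forall>i\<in>{Db+1..D}. bounded_operator_into_C \<Omega> (L i))"

text \<open>
  The functional \<open>\<delta>\<^sub>x \<circ> L\<^sub>i\<close>. It is bounded whenever \<open>x\<close> lies in the set on which \<open>L\<^sub>i\<close> takes
  its values, and \<^const>\<open>Blinfun\<close> is meaningful only then.
\<close>

definition eval_functional ::
    "(nat \<Rightarrow> 'u::real_normed_vector \<Rightarrow> 'a \<Rightarrow> real) \<Rightarrow> 'a \<Rightarrow> nat \<Rightarrow> 'u \<Rightarrow>\<^sub>L real" where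
  "eval_functional L x i = Blinfun (\<lambda>u. L i u x)"

text \<open>
  Vectors of functionals are lists. \<open>functionals L a b xs\<close> lists \<open>\<delta>\<^sub>x \<circ> L\<^sub>i\<close> for \<open>x\<close> in \<open>xs\<close> and
  \<open>a \<le> i \<le> b\<close>.
\<close>

definition functionals ::
    "(nat \<Rightarrow> 'u::real_normed_vector \<Rightarrow> 'a \<Rightarrow> real) \<Rightarrow> nat \<Rightarrow> nat \<Rightarrow> 'a list \<Rightarrow> ('u \<Rightarrow>\<^sub>L real) list" where
  "functionals L a b xs = concat (map (\<lambda>x. map (eval_functional L x) [a..<Suc b]) xs)"

definition gram ::
    "(('u::real_normed_vector \<Rightarrow>\<^sub>L real) \<Rightarrow> 'u) \<Rightarrow> ('u \<Rightarrow>\<^sub>L real) list \<Rightarrow> ('u \<Rightarrow>\<^sub>L real) list \<Rightarrow> real mat" where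
  "gram K \<alpha> \<beta> = mat (length \<alpha>) (length \<beta>) (\<lambda>(i, j). blinfun_apply (\<alpha> ! i) (K (\<beta> ! j)))"

definition mat_trace :: "real mat \<Rightarrow> real" where
  "mat_trace A = (\<Sum>i<dim_row A. A $$ (i, i))"

text \<open>
  The \<open>j\<close>-th largest eigenvalue (counting from 1, with multiplicity) of a symmetric real matrix,
  all of whose eigenvalues are real; 0 for \<open>j\<close> beyond the size of the matrix.
\<close>

definition eig_desc :: "real mat \<Rightarrow> nat \<Rightarrow> real" where
  "eig_desc A j =
     (if 1 \<le> j \<and> j \<le> dim_row A
      then rev (sorted_list_of_multiset (proots (char_poly A))) ! (j - 1) else 0)"

definition space_Ha ::
    "(('u::real_normed_vector \<Rightarrow>\<^sub>L real) \<Rightarrow> 'u) \<Rightarrow> ('u \<Rightarrow>\<^sub>L real) list \<Rightarrow> 'u set" where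
  "space_Ha K \<phi> = span (set (map K \<phi>))"

definition space_Hb ::
    "(('u::real_normed_vector \<Rightarrow>\<^sub>L real) \<Rightarrow> 'u) \<Rightarrow> ('u \<Rightarrow>\<^sub>L real) list \<Rightarrow> 'u set" where
  "space_Hb K \<psi> =
     {(\<Sum>j<length \<psi>. \<beta> j *\<^sub>R K (\<psi> ! j)) | \<beta>. L2_set \<beta> {..<length \<psi>} \<le> 1}"

text \<open>
  The maximum over \<open>Hb\<close> of the minimum over \<open>Ha\<close>, written as supremum and infimum in the extended
  reals, where both always exist. Both are attained if \<open>Hb\<close> is compact and \<open>Ha\<close> is a
  finite-dimensional subspace.
\<close>

definition approx_error :: "'u::real_normed_vector set \<Rightarrow> 'u set \<Rightarrow> ereal" where
  "approx_error Ha Hb = (SUP h\<in>Hb. INF v\<in>Ha. ereal ((norm (v - h))\<^sup>2))"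

text \<open>\<open>m\<close> independent draws from the entries of a nonempty list \<open>xs\<close>, each entry being equally likely.\<close>

definition uniform_sample :: "nat \<Rightarrow> 'a list \<Rightarrow> 'a list pmf" where
  "uniform_sample m xs = replicate_pmf m (pmf_of_multiset (mset xs))"

end

theory Submission
  imports Defs
begin

text \<open>
  Work in \<open>\<U>\<^sup>*\<close> with the inner product \<open>[\<phi>, \<K>\<psi>]\<close>, which \<open>\<K>\<close> carries
  isometrically to \<open>\<U>\<close>, and treat the interior and the boundary block separately.
  Let \<open>w = h - v\<close> be the residual of the orthogonal projection of
  \<open>h = \<beta>\<^sup>T\<psi>\<close> to the sampled span, \<open>T = \<Sum>i. \<psi>\<^sub>i \<otimes> \<psi>\<^sub>i\<close>, and \<open>\<epsilon>\<close> the
  Hilbert-Schmidt norm of \<open>T - (N / M) S\<close>, where \<open>S\<close> sums the same rank-one operators over the sample. As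
  \<open>S w = 0\<close>, we have \<open>\<bar>T w\<bar> \<le> \<epsilon>\<bar>w\<bar>\<close>. Since
  \<open>\<bar>w\<bar>\<^sup>4 = [h, \<K>w]\<^sup>2 \<le> \<bar>\<beta>\<bar>\<^sup>2 [T w, \<K>w]\<close>, splitting the spectrum of \<open>T\<close> at
  \<open>\<lambda>\<^sub>r\<close> gives \<open>\<bar>w\<bar>\<^sup>2 \<le> \<epsilon>\<^sup>2 / \<lambda>\<^sub>r + \<lambda>\<^bsub>r+1\<^esub>\<close>. A bound on the
  exponential moments of \<open>sqrt (b\<^sup>2 + \<bar>s\<bar>\<^sup>2)\<close> along the random sum \<open>s\<close> of the centered
  operators shows that \<open>\<epsilon>\<close> is at most of order \<open>C\<^sub>0 N ln (2 / \<delta>) / sqrt M\<close> with probability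
  \<open>1 - \<delta> / 2\<close> for each block, and the union bound concludes.
\<close>

section \<open>Spectral theorem for symmetric real matrices\<close>

no_notation inner (infix "\<bullet>" 70)

text \<open>A complex root \<open>k\<close> of the characteristic polynomial has an eigenvector
  \<open>a + i b\<close> with real vectors \<open>a\<close> and \<open>b\<close>. Comparing
  \<open>b \<bullet> A a\<close> with \<open>A b \<bullet> a\<close> gives
  \<open>Im k (|a|^2 + |b|^2) = 0\<close>, so \<open>k\<close> is real, and whichever of
  \<open>a\<close> and \<open>b\<close> is nonzero yields a real eigenvector after
  normalization.\<close>

lemma symmetric_mat_eigenvector:
  fixes A :: "real mat"
  assumes A: "A \<in> carrier_mat n n" and sym: "A\<^sup>T = A" and "n > 0"
  obtains v c where "v \<in> carrier_vec n" "v \<bullet> v = 1" "A *\<^sub>v v = c \<cdot>\<^sub>v v"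
proof -
  let ?B = "map_mat complex_of_real A"
  have B: "?B \<in> carrier_mat n n" using A by simp
  from char_poly_factorized[OF B] obtain as where
    as: "char_poly ?B = (\<Prod>a\<leftarrow>as. [:- a, 1:])" "length as = n" by blast
  with \<open>n > 0\<close> obtain k as' where "as = k # as'" by (cases as) auto
  with as have "poly (char_poly ?B) k = 0" by simp
  then obtain w where w: "w \<in> carrier_vec n" "w \<noteq> 0\<^sub>v n" "?B *\<^sub>v w = k \<cdot>\<^sub>v w"
    using eigenvalue_root_char_poly[OF B] A by (auto simp: eigenvalue_def eigenvector_def)
  define a where "a = vec n (\<lambda>i. Re (w $ i))"
  define b where "b = vec n (\<lambda>i. Im (w $ i))"
  have carr [simp]: "a \<in> carrier_vec n" "b \<in> carrier_vec n" by (auto simp: a_def b_def)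
  have row: "(\<Sum>j<n. complex_of_real (A $$ (i,j)) * w $ j) = k * w $ i" if "i < n" for i
  proof -
    have "(?B *\<^sub>v w) $ i = (k \<cdot>\<^sub>v w) $ i" using w by simp
    then show ?thesis using that A w(1)
      by (simp add: scalar_prod_def lessThan_atLeast0 row_def)
  qed
  have Aa: "A *\<^sub>v a = Re k \<cdot>\<^sub>v a - Im k \<cdot>\<^sub>v b"
  proof (rule eq_vecI)
    fix i assume "i < dim_vec (Re k \<cdot>\<^sub>v a - Im k \<cdot>\<^sub>v b)"
    then have i: "i < n" by (simp add: b_def)
    then show "(A *\<^sub>v a) $ i = (Re k \<cdot>\<^sub>v a - Im k \<cdot>\<^sub>v b) $ i"
      using arg_cong[OF row[OF i], of Re] A
      by (simp add: scalar_prod_def lessThan_atLeast0 row_def a_def b_def)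
  qed (use A in \<open>simp add: b_def\<close>)
  have Ab: "A *\<^sub>v b = Re k \<cdot>\<^sub>v b + Im k \<cdot>\<^sub>v a"
  proof (rule eq_vecI)
    fix i assume "i < dim_vec (Re k \<cdot>\<^sub>v b + Im k \<cdot>\<^sub>v a)"
    then have i: "i < n" by (simp add: a_def)
    then show "(A *\<^sub>v b) $ i = (Re k \<cdot>\<^sub>v b + Im k \<cdot>\<^sub>v a) $ i"
      using arg_cong[OF row[OF i], of Im] A
      by (simp add: scalar_prod_def lessThan_atLeast0 row_def a_def b_def)
  qed (use A in \<open>simp add: a_def\<close>)
  have "b \<bullet> (A *\<^sub>v a) = (A *\<^sub>v b) \<bullet> a"
    using transpose_vec_mult_scalar[OF A, of a b] sym by simp
  then have "Im k * (a \<bullet> a + b \<bullet> b) = 0"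
    unfolding Aa Ab
    by (simp add: scalar_prod_minus_distrib[of _ n] add_scalar_prod_distrib[of _ n]
        smult_scalar_prod_distrib[of _ n] scalar_prod_smult_distrib[of _ n]
        comm_scalar_prod[of b n a] algebra_simps)
  moreover have pos: "a \<bullet> a + b \<bullet> b > 0"
  proof -
    obtain i where i: "i < n" "w $ i \<noteq> 0"
      using w by (metis carrier_vecD eq_vecI index_zero_vec)
    have "a \<bullet> a + b \<bullet> b = (\<Sum>i<n. (cmod (w $ i))\<^sup>2)"
      by (simp add: scalar_prod_def lessThan_atLeast0 a_def b_def cmod_power2 power2_eq_square
          flip: sum.distrib add: cmod_power2[unfolded power2_eq_square])
    also have "\<dots> > 0" by (rule sum_pos2[of _ i]) (use i in auto)
    finally show ?thesis .
  qed
  ultimately have im: "Im k = 0" by auto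
  have *: "\<exists>u. u \<in> carrier_vec n \<and> u \<bullet> u > 0 \<and> A *\<^sub>v u = Re k \<cdot>\<^sub>v u"
  proof (cases "a \<bullet> a > 0")
    case True
    then show ?thesis using Aa im by (intro exI[of _ a]) (auto simp: b_def a_def)
  next
    case False
    with pos have "b \<bullet> b > 0" by simp
    then show ?thesis using Ab im by (intro exI[of _ b]) (auto simp: b_def a_def)
  qed
  then obtain u where u: "u \<in> carrier_vec n" "u \<bullet> u > 0" "A *\<^sub>v u = Re k \<cdot>\<^sub>v u" by blast
  show ?thesis
  proof (rule that)
    let ?v = "(1 / sqrt (u \<bullet> u)) \<cdot>\<^sub>v u"
    show "?v \<in> carrier_vec n" using u by simp
    show "?v \<bullet> ?v = 1" using u(2) u(1) by (simp add: field_simps)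
    show "A *\<^sub>v ?v = Re k \<cdot>\<^sub>v ?v"
      using u mult_mat_vec[OF A u(1)] by (simp add: smult_smult_assoc mult.commute)
  qed
qed

text \<open>
  The Householder reflection in the hyperplane orthogonal to \<open>v - e\<^sub>0\<close>. If \<open>v = e\<^sub>0\<close>,
  then division by zero makes the correction term vanish.
\<close>

lemma symmetric_orthogonal_mat_first_col:
  fixes v :: "real vec"
  assumes v: "v \<in> carrier_vec n" "v \<bullet> v = 1" and "n > 0"
  obtains W where "W \<in> carrier_mat n n" "W\<^sup>T = W" "W * W = 1\<^sub>m n" "col W 0 = v"
proof -
  define u where "u i = v $ i - (if i = 0 then 1 else 0)" for i
  define s where "s = (\<Sum>i<n. (u i)\<^sup>2)"
  define W where "W = mat n n (\<lambda>(i, j). (if i = j then 1 else 0) - 2 * u i * u j / s)"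
  have vv: "(\<Sum>i<n. v $ i * v $ i) = 1"
    using v by (simp add: scalar_prod_def lessThan_atLeast0)
  have s: "s = 2 - 2 * v $ 0"
  proof -
    have "s = (\<Sum>i<n. v $ i * v $ i - (if i = 0 then 2 * v $ 0 - 1 else 0))"
      unfolding s_def u_def by (intro sum.cong) (auto simp: power2_eq_square algebra_simps)
    also have "\<dots> = 2 - 2 * v $ 0" using \<open>n > 0\<close> by (simp add: sum_subtractf vv)
    finally show ?thesis .
  qed
  have u_eq_0: "u i = 0" if "s = 0" "i < n" for i
    using that unfolding s_def by (simp add: sum_nonneg_eq_0_iff)
  show ?thesis
  proof (rule that)
    show "W \<in> carrier_mat n n" by (simp add: W_def)
    show "W\<^sup>T = W" by (rule eq_matI) (auto simp: W_def)
    show "col W 0 = v"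
    proof (rule eq_vecI)
      fix i assume "i < dim_vec v"
      then have i: "i < n" using v by simp
      show "col W 0 $ i = v $ i"
      proof (cases "s = 0")
        case True
        with u_eq_0[OF True i] i \<open>n > 0\<close> show ?thesis by (simp add: W_def u_def)
      next
        case False
        \<comment> \<open>\<open>u 0 = v $ 0 - 1 = - s / 2\<close>, because \<open>v\<close> is a
          unit vector; hence the reflection adds exactly \<open>u\<close> to the first unit vector,
          which gives \<open>v\<close>.\<close>
        have u0: "u 0 / s = - 1 / 2" using False s by (simp add: u_def field_simps)
        have "(if i = 0 then 1 else 0) - 2 * u i * u 0 / s = (if i = 0 then 1 else 0) - 2 * u i * (u 0 / s)"
          by simp
        also have "\<dots> = v $ i" unfolding u0 by (simp add: u_def field_simps)
        finally have "(if i = 0 then 1 else 0) - 2 * u i * u 0 / s = v $ i" .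
        then show ?thesis using i \<open>n > 0\<close> by (simp add: W_def)
      qed
    qed (use v in \<open>simp add: W_def\<close>)
    show "W * W = 1\<^sub>m n"
    proof (rule eq_matI)
      fix i j assume "i < dim_row (1\<^sub>m n)" "j < dim_col (1\<^sub>m n :: real mat)"
      then have ij: "i < n" "j < n" by auto
      have "(W * W) $$ (i, j) = (\<Sum>k<n. ((if i = k then 1 else 0) - 2 * u i * u k / s)
          * ((if k = j then 1 else 0) - 2 * u k * u j / s))"
        using ij by (simp add: W_def scalar_prod_def lessThan_atLeast0)
      also have "\<dots> = (\<Sum>k<n. (if k = i then (if i = j then 1 else 0) - 2 * u i * u j / s else 0)
          - (if k = j then 2 * u i * u j / s else 0) + 4 * u i * u j / s^2 * (u k)\<^sup>2)"
        by (intro sum.cong refl) (cases "s = 0"; auto simp: field_simps power2_eq_square)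
      also have "\<dots> = (if i = j then 1 else 0) - 4 * u i * u j / s + 4 * u i * u j / s^2 * s"
      proof -
        have "(\<Sum>k<n. 4 * u i * u j / s^2 * (u k)\<^sup>2) = 4 * u i * u j / s^2 * s"
          by (simp only: s_def sum_distrib_left)
        then show ?thesis using ij by (simp add: sum.distrib sum_subtractf)
      qed
      also have "\<dots> = 1\<^sub>m n $$ (i, j)" using ij by (simp add: power2_eq_square)
      finally show "(W * W) $$ (i, j) = 1\<^sub>m n $$ (i, j)" .
    qed (auto simp: W_def)
  qed
qed

text \<open>Deflation: conjugation by a reflection whose first column is a unit eigenvector makes
  the first column a multiple of the first unit vector. By symmetry the same holds for the first
  row, and induction diagonalizes the remaining block.\<close>

lemma symmetric_mat_diagonalization:
  fixes A :: "real mat"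
  assumes "A \<in> carrier_mat n n" "A\<^sup>T = A"
  shows "\<exists>U D. U \<in> carrier_mat n n \<and> D \<in> carrier_mat n n \<and> U\<^sup>T * U = 1\<^sub>m n \<and> U * U\<^sup>T = 1\<^sub>m n
    \<and> diagonal_mat D \<and> A = U * D * U\<^sup>T"
  using assms
proof (induction n arbitrary: A)
  case 0
  then show ?case by (intro exI[of _ "1\<^sub>m 0"]) (auto simp: diagonal_mat_def)
next
  case (Suc n)
  note A = Suc.prems(1) and sym = Suc.prems(2)
  obtain v c where v: "v \<in> carrier_vec (Suc n)" "v \<bullet> v = 1" "A *\<^sub>v v = c \<cdot>\<^sub>v v"
    using symmetric_mat_eigenvector[OF A sym] by blast
  obtain W where W: "W \<in> carrier_mat (Suc n) (Suc n)" "W\<^sup>T = W" "W * W = 1\<^sub>m (Suc n)" "col W 0 = v"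
    using symmetric_orthogonal_mat_first_col[OF v(1,2)] by blast
  define F where "F = W * A * W"
  have F: "F \<in> carrier_mat (Suc n) (Suc n)" using A W by (simp add: F_def)
  have F_sym: "F\<^sup>T = F"
  proof -
    have "F\<^sup>T = W\<^sup>T * (W * A)\<^sup>T"
      unfolding F_def by (rule transpose_mult[of _ "Suc n" "Suc n"]) (use A W in auto)
    also have "(W * A)\<^sup>T = A\<^sup>T * W\<^sup>T"
      by (rule transpose_mult[of _ "Suc n" "Suc n"]) (use A W in auto)
    finally show ?thesis
      using W(1,2) A sym by (simp add: F_def assoc_mult_mat[of _ "Suc n" "Suc n" _ "Suc n" _ "Suc n"])
  qed
  have "col F 0 = (W * A) *\<^sub>v col W 0"
    unfolding F_def by (rule col_mult2[of _ "Suc n" "Suc n" _ "Suc n"]) (use A W in auto)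
  also have "\<dots> = W *\<^sub>v (A *\<^sub>v v)"
    unfolding W(4) by (rule assoc_mult_mat_vec[of _ "Suc n" "Suc n" _ "Suc n"]) (use A W v in auto)
  also have "\<dots> = c \<cdot>\<^sub>v (W *\<^sub>v col W 0)" using v W mult_mat_vec[OF W(1) v(1)] by simp
  \<comment> \<open>\<open>W\<close> is an involution, so it sends its first column back to the
    first unit vector.\<close>
  also have "W *\<^sub>v col W 0 = col (W * W) 0"
    by (rule col_mult2[of _ "Suc n" "Suc n" _ "Suc n", symmetric]) (use W in auto)
  finally have col0: "col F 0 = c \<cdot>\<^sub>v unit_vec (Suc n) 0" using W(3) by simp
  have F_i0: "F $$ (i, 0) = (if i = 0 then c else 0)" if "i < Suc n" for i
    using arg_cong[OF col0, of "\<lambda>x. vec_index x i"] that F by (simp add: unit_vec_def)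
  have F_0i: "F $$ (0, i) = (if i = 0 then c else 0)" if "i < Suc n" for i
    using F_i0[OF that] F that by (metis F_sym index_transpose_mat(1) carrier_matD zero_less_Suc)
  define A' where "A' = mat n n (\<lambda>(i, j). F $$ (Suc i, Suc j))"
  have A': "A' \<in> carrier_mat n n" by (simp add: A'_def)
  have "A'\<^sup>T = A'"
  proof (rule eq_matI)
    fix i j assume "i < dim_row A'" "j < dim_col A'"
    then show "A'\<^sup>T $$ (i, j) = A' $$ (i, j)"
      using arg_cong[OF F_sym, of "\<lambda>x. x $$ (Suc i, Suc j)"] F by (simp add: A'_def)
  qed (auto simp: A'_def)
  from Suc.IH[OF A' this] obtain U' D' where
    U': "U' \<in> carrier_mat n n" and D': "D' \<in> carrier_mat n n" and
    orth: "U'\<^sup>T * U' = 1\<^sub>m n" "U' * U'\<^sup>T = 1\<^sub>m n" and diag: "diagonal_mat D'" and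
    A'_eq: "A' = U' * D' * U'\<^sup>T"
    by blast
  define V where "V = four_block_mat (1\<^sub>m 1) (0\<^sub>m 1 n) (0\<^sub>m n 1) U'"
  define D where "D = four_block_mat (c \<cdot>\<^sub>m 1\<^sub>m 1) (0\<^sub>m 1 n) (0\<^sub>m n 1) D'"
  have V: "V \<in> carrier_mat (Suc n) (Suc n)"
    using four_block_carrier_mat[of "1\<^sub>m 1" 1 1 U' n n] U' by (simp add: V_def)
  have D: "D \<in> carrier_mat (Suc n) (Suc n)"
    using four_block_carrier_mat[of "c \<cdot>\<^sub>m 1\<^sub>m 1" 1 1 D' n n] D' by (simp add: D_def)
  have VT: "V\<^sup>T = four_block_mat (1\<^sub>m 1) (0\<^sub>m 1 n) (0\<^sub>m n 1) U'\<^sup>T"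
    unfolding V_def by (subst transpose_four_block_mat[of _ 1 1 _ n _ n]) (use U' in auto)
  have one: "four_block_mat (1\<^sub>m 1) (0\<^sub>m 1 n) (0\<^sub>m n 1) (1\<^sub>m n) = (1\<^sub>m (Suc n) :: real mat)"
    by (rule eq_matI) auto
  have VTV: "V\<^sup>T * V = 1\<^sub>m (Suc n)" "V * V\<^sup>T = 1\<^sub>m (Suc n)"
    unfolding VT unfolding V_def
    by (subst mult_four_block_mat[of _ 1 1 _ n _ n _ _ 1 _ n], use U' orth one in auto)+
  have VDV: "V * D * V\<^sup>T = four_block_mat (c \<cdot>\<^sub>m 1\<^sub>m 1) (0\<^sub>m 1 n) (0\<^sub>m n 1) A'"
    unfolding VT unfolding V_def D_def A'_eq
    apply (subst mult_four_block_mat[of _ 1 1 _ n _ n _ _ 1 _ n], use U' D' in auto)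
    apply (subst mult_four_block_mat[of _ 1 1 _ n _ n _ _ 1 _ n], use U' D' in auto)
    done
  have F_eq: "F = V * D * V\<^sup>T"
    unfolding VDV
    by (rule eq_matI) (use F F_i0 F_0i in \<open>auto simp: A'_def less_Suc_eq_0_disj\<close>)
  define U where "U = W * V"
  have U: "U \<in> carrier_mat (Suc n) (Suc n)" using W V by (simp add: U_def)
  have UT: "U\<^sup>T = V\<^sup>T * W" using W V by (simp add: U_def transpose_mult[of _ "Suc n" "Suc n"])
  note assoc = assoc_mult_mat[of _ "Suc n" "Suc n" _ "Suc n" _ "Suc n"]
  have "U\<^sup>T * U = V\<^sup>T * (W * W) * V" unfolding UT using W(1) V by (simp add: U_def assoc)
  then have 1: "U\<^sup>T * U = 1\<^sub>m (Suc n)" using W(3) V VTV by simp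
  have "U * U\<^sup>T = W * (V * V\<^sup>T) * W" unfolding UT using W(1) V by (simp add: U_def assoc)
  then have 2: "U * U\<^sup>T = 1\<^sub>m (Suc n)" using W V VTV by simp
  have "U * D * U\<^sup>T = W * F * W" unfolding UT using W(1) V D by (simp add: U_def F_eq assoc)
  also have "\<dots> = (W * W) * A * (W * W)" using W(1) A by (simp add: F_def assoc)
  also have "\<dots> = A" using W(3) A by simp
  finally have 3: "A = U * D * U\<^sup>T" by simp
  have 4: "diagonal_mat D"
    unfolding diagonal_mat_def
  proof (intro allI impI)
    fix i j assume "i < dim_row D" "j < dim_col D" "i \<noteq> j"
    then show "D $$ (i, j) = 0"
      using D' diag by (auto simp: D_def diagonal_mat_def less_Suc_eq_0_disj)
  qed
  show ?case using U D 1 2 3 4 by blast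
qed

section \<open>Eigenvalues in descending order and orthonormal eigenbases\<close>

lemma eig_desc_char_poly:
  assumes "A \<in> carrier_mat n n" and "char_poly A = (\<Prod>a\<leftarrow>es. [:- a, 1:])" and "j < n"
  shows "eig_desc A (Suc j) = rev (sort es) ! j"
proof -
  have "proots (\<Prod>a\<leftarrow>es. [:- a, 1:]) = mset es"
  proof (induction es)
    case (Cons e es)
    have "(\<Prod>a\<leftarrow>es. [:- a, 1:]) \<noteq> 0" by (auto simp: prod_list_zero_iff)
    then have "proots (\<Prod>a\<leftarrow>e # es. [:- a, 1:]) = proots [:- e, 1:] + proots (\<Prod>a\<leftarrow>es. [:- a, 1:])"
      by (simp del: mult_pCons_left add: proots_mult)
    then show ?case using Cons.IH by simp
  qed simp
  then show ?thesis using assms by (simp add: eig_desc_def)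
qed

lemma eig_desc_antimono:
  assumes "A \<in> carrier_mat n n" and "char_poly A = (\<Prod>a\<leftarrow>es. [:- a, 1:])" and "length es = n"
    and "i \<le> j" "j < n"
  shows "eig_desc A (Suc j) \<le> eig_desc A (Suc i)"
proof -
  have "sorted_wrt (\<ge>) (rev (sort es))" by (simp add: sorted_wrt_rev)
  then have "rev (sort es) ! j \<le> rev (sort es) ! i"
    using assms by (cases "i = j") (auto simp: sorted_wrt_iff_nth_less)
  then show ?thesis using assms by (simp add: eig_desc_char_poly)
qed

text \<open>The basis consists of the columns of the diagonalizing matrix, permuted into the order
  of \<open>eig_desc\<close>. Orthonormality is recorded for columns and for rows, so that a family
  of vectors can be transformed to the eigenbasis and back.\<close>

theorem symmetric_mat_eigenbasis:
  fixes A :: "real mat"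
  assumes A: "A \<in> carrier_mat n n" and sym: "A\<^sup>T = A"
  obtains u :: "nat \<Rightarrow> nat \<Rightarrow> real" where
    "\<And>j k. j < n \<Longrightarrow> k < n \<Longrightarrow> (\<Sum>i<n. u i j * u i k) = (if j = k then 1 else 0)"
    "\<And>i l. i < n \<Longrightarrow> l < n \<Longrightarrow> (\<Sum>j<n. u i j * u l j) = (if i = l then 1 else 0)"
    "\<And>i k. i < n \<Longrightarrow> k < n \<Longrightarrow> (\<Sum>l<n. A $$ (i, l) * u l k) = eig_desc A (Suc k) * u i k"
    "\<And>i j. i \<le> j \<Longrightarrow> j < n \<Longrightarrow> eig_desc A (Suc j) \<le> eig_desc A (Suc i)"
proof -
  obtain U D where U: "U \<in> carrier_mat n n" and D: "D \<in> carrier_mat n n" and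
    UTU: "U\<^sup>T * U = 1\<^sub>m n" and UUT: "U * U\<^sup>T = 1\<^sub>m n" and
    diag: "diagonal_mat D" and eq: "A = U * D * U\<^sup>T"
    using symmetric_mat_diagonalization[OF A sym] by blast
  define es where "es = diag_mat D"
  have len: "length es = n" using D by (simp add: es_def diag_mat_def)
  have "similar_mat_wit A D U U\<^sup>T"
    using A U D UTU UUT eq by (simp add: similar_mat_wit_def Let_def)
  then have "char_poly A = char_poly D" by (intro char_poly_similar) (auto simp: similar_mat_def)
  also have "\<dots> = (\<Prod>a\<leftarrow>es. [:- a, 1:])"
    unfolding es_def
    by (rule char_poly_upper_triangular[OF D]) (use D diag in \<open>auto simp: upper_triangular_def diagonal_mat_def\<close>)
  finally have cp: "char_poly A = (\<Prod>a\<leftarrow>es. [:- a, 1:])" .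
  obtain p where p: "p permutes {..<length es}" "permute_list p es = rev (sort es)"
    by (rule mset_eq_permutation[of "rev (sort es)" es]) auto
  have p_lt: "p k < n" if "k < n" for k using permutes_in_image[OF p(1), of k] that len by simp
  have p_inj: "p j = p k \<longleftrightarrow> j = k" for j k using permutes_inj[OF p(1)] by (auto dest: injD)
  have eig: "eig_desc A (Suc k) = D $$ (p k, p k)" if "k < n" for k
  proof -
    have "eig_desc A (Suc k) = permute_list p es ! k" using eig_desc_char_poly[OF A cp that] p(2) by simp
    also have "\<dots> = es ! p k" by (rule permute_list_nth[OF p(1)]) (use that len in simp)
    also have "\<dots> = D $$ (p k, p k)" using p_lt[OF that] D by (simp add: es_def diag_mat_def)
    finally show ?thesis .
  qed
  have "A * U = U * D * (U\<^sup>T * U)"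
    unfolding eq using U D by (simp add: assoc_mult_mat[of _ n n _ n _ n])
  then have AU: "A * U = U * D" using UTU U D by simp
  show ?thesis
  proof (rule that[of "\<lambda>i j. U $$ (i, p j)"])
    fix j k assume "j < n" "k < n"
    then show "(\<Sum>i<n. U $$ (i, p j) * U $$ (i, p k)) = (if j = k then 1 else 0)"
      using arg_cong[OF UTU, of "\<lambda>M. M $$ (p j, p k)"] U p_lt p_inj
      by (simp add: scalar_prod_def lessThan_atLeast0)
  next
    fix i l assume il: "i < n" "l < n"
    have "(\<Sum>j<n. U $$ (i, p j) * U $$ (l, p j)) = (\<Sum>j<n. U $$ (i, j) * U $$ (l, j))"
      using sum.permute[OF p(1), of "\<lambda>j. U $$ (i, j) * U $$ (l, j)"] len by (simp add: o_def)
    then show "(\<Sum>j<n. U $$ (i, p j) * U $$ (l, p j)) = (if i = l then 1 else 0)"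
      using arg_cong[OF UUT, of "\<lambda>M. M $$ (i, l)"] U il
      by (simp add: scalar_prod_def lessThan_atLeast0)
  next
    fix i k assume ik: "i < n" "k < n"
    have "(\<Sum>l<n. A $$ (i, l) * U $$ (l, p k)) = (A * U) $$ (i, p k)"
      using A U ik p_lt by (simp add: scalar_prod_def lessThan_atLeast0)
    also have "\<dots> = (\<Sum>l<n. U $$ (i, l) * D $$ (l, p k))"
      unfolding AU using D U ik p_lt by (simp add: scalar_prod_def lessThan_atLeast0)
    also have "\<dots> = (\<Sum>l<n. if l = p k then U $$ (i, l) * D $$ (l, p k) else 0)"
      using diag D p_lt[OF ik(2)] by (intro sum.cong) (auto simp: diagonal_mat_def)
    also have "\<dots> = eig_desc A (Suc k) * U $$ (i, p k)" using p_lt[OF ik(2)] eig[OF ik(2)] by simp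
    finally show "(\<Sum>l<n. A $$ (i, l) * U $$ (l, p k)) = eig_desc A (Suc k) * U $$ (i, p k)" .
  next
    fix i j assume "i \<le> j" "j < n"
    then show "eig_desc A (Suc j) \<le> eig_desc A (Suc i)" by (rule eig_desc_antimono[OF A cp len])
  qed
qed

section \<open>Concentration of sums of independent random vectors\<close>

text \<open>For negative \<open>t = - u\<close> the quadratic Taylor bound below
  \<open>exp u\<close> suffices, because \<open>(1 - u + u^2) (1 + u + u^2 / 2) \<ge> 1\<close>. The
  linear term is kept exactly, so that it disappears on averaging over a centered
  \<open>t\<close>.\<close>

lemma exp_le_quadratic:
  fixes t :: real
  assumes "\<bar>t\<bar> \<le> 1"
  shows "exp t \<le> 1 + t + t\<^sup>2"
proof (cases "t \<ge> 0")
  case True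
  then show ?thesis using exp_bound[of t] assms by simp
next
  case False
  define u where "u = - t"
  have u: "u \<ge> 0" using False by (simp add: u_def)
  have "1 \<le> (1 - u + u\<^sup>2) * (1 + u + u\<^sup>2 / 2)"
  proof -
    have "(1 - u + u\<^sup>2) * (1 + u + u\<^sup>2 / 2) = 1 + u\<^sup>2 / 2 + u^3 / 2 + u^4 / 2"
      by (simp add: algebra_simps power2_eq_square power3_eq_cube power4_eq_xxxx field_simps)
    then show ?thesis using u by simp
  qed
  also have "\<dots> \<le> (1 - u + u\<^sup>2) * exp u"
  proof (rule mult_left_mono)
    show "1 + u + u\<^sup>2 / 2 \<le> exp u" using exp_lower_Taylor_quadratic[OF u] by simp
    have "0 \<le> (u - 1/2)\<^sup>2" by simp
    then show "0 \<le> 1 - u + u\<^sup>2" by (simp add: power2_eq_square algebra_simps)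
  qed
  finally have "exp (- u) \<le> 1 - u + u\<^sup>2"
    by (simp add: exp_minus field_simps)
  then show ?thesis by (simp add: u_def)
qed

text \<open>
  The square root is smooth and has gradient at most 1, so that it replaces the norm of \<open>s\<close> in
  the exponential moment method; concavity of the square root linearizes it in \<open>X y\<close>.
\<close>

lemma exp_moment_step:
  fixes X :: "'a \<Rightarrow> 'j \<Rightarrow> real" and p :: "'a pmf"
  assumes fin: "finite (set_pmf p)" and J: "finite J"
    and X: "\<And>y. y \<in> set_pmf p \<Longrightarrow> (\<Sum>j\<in>J. (X y j)\<^sup>2) \<le> c\<^sup>2"
    and mean: "\<And>j. j \<in> J \<Longrightarrow> (\<Sum>y\<in>set_pmf p. pmf p y * X y j) = 0"
    and a: "0 < a" "a * c \<le> 1" and b: "0 < b" and c: "0 \<le> c"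
  shows "(\<Sum>y\<in>set_pmf p. pmf p y * exp (a * sqrt (b\<^sup>2 + (\<Sum>j\<in>J. (s j + X y j)\<^sup>2))))
    \<le> exp (a * sqrt (b\<^sup>2 + (\<Sum>j\<in>J. (s j)\<^sup>2)) + (a\<^sup>2 * c\<^sup>2 + a * c\<^sup>2 / (2 * b)))"
proof -
  define g where "g = sqrt (b\<^sup>2 + (\<Sum>j\<in>J. (s j)\<^sup>2))"
  \<comment> \<open>\<open>t y\<close> is \<open>a\<close> times the derivative of the smoothed norm
    at \<open>s\<close> in the direction \<open>X y\<close>; being linear in \<open>X y\<close>, it
    has mean zero.\<close>
  define t where "t y = a * (\<Sum>j\<in>J. s j * X y j) / g" for y
  have nn: "0 \<le> (\<Sum>j\<in>J. (s j)\<^sup>2)" by (simp add: sum_nonneg)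
  have gb: "b \<le> g" unfolding g_def using nn b by (intro real_le_rsqrt) simp
  have g0: "0 < g" using gb b by simp
  have gg: "g\<^sup>2 = b\<^sup>2 + (\<Sum>j\<in>J. (s j)\<^sup>2)" using nn by (simp add: g_def)
  have point: "exp (a * sqrt (b\<^sup>2 + (\<Sum>j\<in>J. (s j + X y j)\<^sup>2)))
      \<le> exp (a * g + a * c\<^sup>2 / (2 * b)) * (1 + t y + a\<^sup>2 * c\<^sup>2)" if y: "y \<in> set_pmf p" for y
  proof -
    let ?u = "b\<^sup>2 + (\<Sum>j\<in>J. (s j + X y j)\<^sup>2)"
    have u0: "0 \<le> ?u" by (intro add_nonneg_nonneg sum_nonneg) auto
    have u: "?u = g\<^sup>2 + 2 * (\<Sum>j\<in>J. s j * X y j) + (\<Sum>j\<in>J. (X y j)\<^sup>2)"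
      unfolding gg by (simp add: power2_sum sum.distrib sum_distrib_left mult.assoc)
    \<comment> \<open>The square root lies below its tangent at \<open>g^2\<close>.\<close>
    have "0 \<le> (sqrt ?u - g)\<^sup>2" by simp
    then have "2 * g * sqrt ?u \<le> ?u + g\<^sup>2" using u0 by (simp add: power2_diff algebra_simps)
    also have "\<dots> \<le> 2 * g\<^sup>2 + 2 * (\<Sum>j\<in>J. s j * X y j) + c\<^sup>2" using X[OF y] unfolding u by simp
    finally have "sqrt ?u \<le> (2 * g\<^sup>2 + 2 * (\<Sum>j\<in>J. s j * X y j) + c\<^sup>2) / (2 * g)"
      using g0 by (simp add: pos_le_divide_eq mult.commute)
    also have "\<dots> = g + (\<Sum>j\<in>J. s j * X y j) / g + c\<^sup>2 / (2 * g)"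
      using g0 by (simp add: field_simps power2_eq_square)
    \<comment> \<open>The smoothing by \<open>b\<close> enters here: it keeps the second-order term
      bounded when \<open>s\<close> is near 0.\<close>
    also have "c\<^sup>2 / (2 * g) \<le> c\<^sup>2 / (2 * b)" using gb b by (intro divide_left_mono) auto
    finally have "a * sqrt ?u \<le> a * (g + (\<Sum>j\<in>J. s j * X y j) / g + c\<^sup>2 / (2 * b))"
      using a by simp
    also have "\<dots> = a * g + a * c\<^sup>2 / (2 * b) + t y" by (simp add: t_def algebra_simps)
    finally have 1: "exp (a * sqrt ?u) \<le> exp (a * g + a * c\<^sup>2 / (2 * b)) * exp (t y)"
      by (simp flip: exp_add)
    have "\<bar>\<Sum>j\<in>J. s j * X y j\<bar> \<le> (\<Sum>j\<in>J. \<bar>s j\<bar> * \<bar>X y j\<bar>)"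
      using sum_abs[of "\<lambda>j. s j * X y j" J] by (simp add: abs_mult)
    also have "\<dots> \<le> L2_set s J * L2_set (X y) J" by (rule L2_set_mult_ineq)
    also have "\<dots> \<le> g * c"
    proof (rule mult_mono)
      show "L2_set s J \<le> g" unfolding L2_set_def g_def by simp
      show "L2_set (X y) J \<le> c" unfolding L2_set_def using X[OF y] c by (intro real_le_lsqrt) auto
    qed (use g0 in auto)
    finally have "a * \<bar>\<Sum>j\<in>J. s j * X y j\<bar> / g \<le> a * (g * c) / g"
      using a g0 by (intro divide_right_mono mult_left_mono) auto
    then have "\<bar>t y\<bar> \<le> a * (g * c) / g"
      unfolding t_def using a g0 by (simp add: abs_mult)
    then have t: "\<bar>t y\<bar> \<le> a * c" using g0 by simp
    have "exp (t y) \<le> 1 + t y + (t y)\<^sup>2" using t a by (intro exp_le_quadratic) simp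
    also have "(t y)\<^sup>2 \<le> a\<^sup>2 * c\<^sup>2" using power_mono[OF t, of 2] by (simp add: power_mult_distrib)
    finally have "exp (t y) \<le> 1 + t y + a\<^sup>2 * c\<^sup>2" by simp
    then show ?thesis by (intro order_trans[OF 1] mult_left_mono) auto
  qed
  have "(\<Sum>y\<in>set_pmf p. pmf p y * t y) = a / g * (\<Sum>j\<in>J. s j * (\<Sum>y\<in>set_pmf p. pmf p y * X y j))"
    unfolding t_def sum_distrib_left sum_divide_distrib
    by (subst sum.swap) (simp add: mult_ac)
  then have t0: "(\<Sum>y\<in>set_pmf p. pmf p y * t y) = 0" using mean by simp
  have p1: "(\<Sum>y\<in>set_pmf p. pmf p y) = 1" using fin by (simp add: sum_pmf_eq_1)
  have "(\<Sum>y\<in>set_pmf p. pmf p y * exp (a * sqrt (b\<^sup>2 + (\<Sum>j\<in>J. (s j + X y j)\<^sup>2))))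
     \<le> (\<Sum>y\<in>set_pmf p. pmf p y * (exp (a * g + a * c\<^sup>2 / (2 * b)) * (1 + t y + a\<^sup>2 * c\<^sup>2)))"
    by (intro sum_mono mult_left_mono point) auto
  also have "\<dots> = exp (a * g + a * c\<^sup>2 / (2 * b)) *
      ((1 + a\<^sup>2 * c\<^sup>2) * (\<Sum>y\<in>set_pmf p. pmf p y) + (\<Sum>y\<in>set_pmf p. pmf p y * t y))"
    by (simp add: sum_distrib_left sum_distrib_right algebra_simps sum.distrib)
  also have "\<dots> = exp (a * g + a * c\<^sup>2 / (2 * b)) * (1 + a\<^sup>2 * c\<^sup>2)" by (simp add: t0 p1)
  also have "\<dots> \<le> exp (a * g + a * c\<^sup>2 / (2 * b)) * exp (a\<^sup>2 * c\<^sup>2)"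
    by (intro mult_left_mono exp_ge_add_one_self) auto
  also have "\<dots> = exp (a * g + (a\<^sup>2 * c\<^sup>2 + a * c\<^sup>2 / (2 * b)))" by (simp flip: exp_add add: algebra_simps)
  finally show ?thesis by (simp add: g_def)
qed

text \<open>Induction over the draws with \<open>s\<close> arbitrary: the first draw shifts the
  starting vector, the induction hypothesis handles the later draws, and averaging over the first
  one costs the same factor once more.\<close>

lemma exp_moment_sample_sum:
  fixes X :: "'a \<Rightarrow> 'j \<Rightarrow> real" and p :: "'a pmf"
  assumes fin: "finite (set_pmf p)" and J: "finite J"
    and X: "\<And>y. y \<in> set_pmf p \<Longrightarrow> (\<Sum>j\<in>J. (X y j)\<^sup>2) \<le> c\<^sup>2"
    and mean: "\<And>j. j \<in> J \<Longrightarrow> (\<Sum>y\<in>set_pmf p. pmf p y * X y j) = 0"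
    and a: "0 < a" "a * c \<le> 1" and b: "0 < b" and c: "0 \<le> c"
  shows "measure_pmf.expectation (replicate_pmf n p)
      (\<lambda>ys. exp (a * sqrt (b\<^sup>2 + (\<Sum>j\<in>J. (s j + (\<Sum>y\<leftarrow>ys. X y j))\<^sup>2))))
    \<le> exp (a * sqrt (b\<^sup>2 + (\<Sum>j\<in>J. (s j)\<^sup>2)) + n * (a\<^sup>2 * c\<^sup>2 + a * c\<^sup>2 / (2 * b)))"
proof (induction n arbitrary: s)
  case 0
  then show ?case by simp
next
  case (Suc n)
  let ?q = "a\<^sup>2 * c\<^sup>2 + a * c\<^sup>2 / (2 * b)"
  let ?h = "\<lambda>s ys. exp (a * sqrt (b\<^sup>2 + (\<Sum>j\<in>J. (s j + (\<Sum>y\<leftarrow>ys. X y j))\<^sup>2)))"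
  have eq: "replicate_pmf (Suc n) p = p \<bind> (\<lambda>x. map_pmf ((#) x) (replicate_pmf n p))"
    by (simp add: map_pmf_def)
  have finr: "finite (set_pmf (map_pmf ((#) x) (replicate_pmf n p)))" for x
  proof -
    have "{xs \<in> lists (set_pmf p). length xs = n} = {xs. set xs \<subseteq> set_pmf p \<and> length xs = n}"
      by auto
    then show ?thesis using finite_lists_length_eq[OF fin, of n]
      by (simp add: set_replicate_pmf)
  qed
  have "measure_pmf.expectation (replicate_pmf (Suc n) p) (?h s)
     = (\<Sum>y\<in>set_pmf p. pmf p y * measure_pmf.expectation (replicate_pmf n p) (?h (\<lambda>j. s j + X y j)))"
    unfolding eq by (subst pmf_expectation_bind[OF fin finr]) (auto simp: add.assoc)
  also have "\<dots> \<le> (\<Sum>y\<in>set_pmf p. pmf p y *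
      exp (a * sqrt (b\<^sup>2 + (\<Sum>j\<in>J. (s j + X y j)\<^sup>2)) + n * ?q))"
    by (intro sum_mono mult_left_mono Suc.IH) auto
  also have "\<dots> = exp (n * ?q) * (\<Sum>y\<in>set_pmf p. pmf p y * exp (a * sqrt (b\<^sup>2 + (\<Sum>j\<in>J. (s j + X y j)\<^sup>2))))"
    unfolding sum_distrib_left exp_add by (intro sum.cong) auto
  also have "\<dots> \<le> exp (n * ?q) * exp (a * sqrt (b\<^sup>2 + (\<Sum>j\<in>J. (s j)\<^sup>2)) + ?q)"
    by (intro mult_left_mono exp_moment_step[OF fin J X mean a b c]) auto
  also have "\<dots> = exp (a * sqrt (b\<^sup>2 + (\<Sum>j\<in>J. (s j)\<^sup>2)) + Suc n * ?q)"
    by (simp flip: exp_add add: algebra_simps add_divide_distrib)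
  finally show ?case .
qed

text \<open>Markov's inequality for the exponential moment of the smoothed norm. The bound is
  independent of the size of \<open>J\<close>, hence of the dimension.\<close>

lemma sample_sum_concentration:
  fixes X :: "'a \<Rightarrow> 'j \<Rightarrow> real" and p :: "'a pmf"
  assumes fin: "finite (set_pmf p)" and J: "finite J"
    and X: "\<And>y. y \<in> set_pmf p \<Longrightarrow> L2_set (X y) J \<le> c"
    and mean: "\<And>j. j \<in> J \<Longrightarrow> measure_pmf.expectation p (\<lambda>y. X y j) = 0"
    and c: "0 < c" and n: "0 < n"
  shows "measure_pmf.prob (replicate_pmf n p)
      {ys. L2_set (\<lambda>j. \<Sum>y\<leftarrow>ys. X y j) J > c * sqrt n * (5/2 + l)} \<le> exp (- l)"
proof -
  define b where "b = c * sqrt n"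
  define a where "a = 1 / b"
  have b: "0 < b" using c n by (simp add: b_def)
  have a: "0 < a" using b by (simp add: a_def)
  have ac: "a * c \<le> 1" using c n by (simp add: a_def b_def)
  have ab: "a * b = 1" using b by (simp add: a_def)
  \<comment> \<open>The draws contribute \<open>1 + 1/2\<close> to the exponent and the starting
    vector 0 contributes \<open>a * b = 1\<close>. The total \<open>5/2\<close> is the offset in the
    deviation threshold.\<close>
  have q: "n * (a\<^sup>2 * c\<^sup>2 + a * c\<^sup>2 / (2 * b)) = 3/2"
    using c n by (simp add: a_def b_def field_simps power2_eq_square)
  have X2: "(\<Sum>j\<in>J. (X y j)\<^sup>2) \<le> c\<^sup>2" if "y \<in> set_pmf p" for y
    using X[OF that] c by (simp add: L2_set_def sqrt_le_D)
  have mean': "(\<Sum>y\<in>set_pmf p. pmf p y * X y j) = 0" if "j \<in> J" for j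
    using mean[OF that] fin by (subst (asm) integral_measure_pmf_real[of "set_pmf p"]) (auto simp: mult.commute)
  define h where "h ys = exp (a * sqrt (b\<^sup>2 + (\<Sum>j\<in>J. (0 + (\<Sum>y\<leftarrow>ys. X y j))\<^sup>2)))" for ys
  have E: "measure_pmf.expectation (replicate_pmf n p) h \<le> exp (5/2)"
    using exp_moment_sample_sum[OF fin J X2 mean' a ac b less_imp_le[OF c], where s = "\<lambda>_. 0" and n = n] b q ab
    unfolding h_def by simp
  let ?S = "{ys. L2_set (\<lambda>j. \<Sum>y\<leftarrow>ys. X y j) J > c * sqrt n * (5/2 + l)}"
  have "{xs \<in> lists (set_pmf p). length xs = n} = {xs. set xs \<subseteq> set_pmf p \<and> length xs = n}" by auto
  then have finr: "finite (set_pmf (replicate_pmf n p))"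
    using finite_lists_length_eq[OF fin, of n] by (simp add: set_replicate_pmf)
  have "measure_pmf.prob (replicate_pmf n p) ?S * exp (5/2 + l)
      = measure_pmf.expectation (replicate_pmf n p) (\<lambda>ys. indicator ?S ys * exp (5/2 + l))"
    by simp
  also have "\<dots> \<le> measure_pmf.expectation (replicate_pmf n p) h"
  proof (rule integral_mono)
    fix ys
    show "indicator ?S ys * exp (5/2 + l) \<le> h ys"
    proof (cases "ys \<in> ?S")
      case True
      then have "b * (5/2 + l) \<le> L2_set (\<lambda>j. \<Sum>y\<leftarrow>ys. X y j) J" by (simp add: b_def)
      also have "\<dots> \<le> sqrt (b\<^sup>2 + (\<Sum>j\<in>J. (0 + (\<Sum>y\<leftarrow>ys. X y j))\<^sup>2))" by (simp add: L2_set_def)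
      finally have "5/2 + l \<le> a * sqrt (b\<^sup>2 + (\<Sum>j\<in>J. (0 + (\<Sum>y\<leftarrow>ys. X y j))\<^sup>2))"
        using b by (simp add: a_def field_simps)
      then show ?thesis using True by (simp add: h_def)
    qed (simp add: h_def)
  qed (intro integrable_measure_pmf_finite finr)+
  also note E
  finally have "measure_pmf.prob (replicate_pmf n p) ?S * exp l \<le> 1"
    by (simp add: exp_add)
  then show ?thesis by (simp add: exp_minus field_simps)
qed

section \<open>Residuals of projections to sampled spans\<close>

text \<open>The form is a parameter because it depends on the operator \<open>K\<close>: the
  instance is \<open>blinfun_apply \<phi> (K \<psi>)\<close> on the dual space.\<close>

locale inner_form =
  fixes B :: "'f::real_vector \<Rightarrow> 'f \<Rightarrow> real"
  assumes linear_left: "linear (\<lambda>x. B x y)"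
    and commute: "B x y = B y x"
    and pos: "x \<noteq> 0 \<Longrightarrow> B x x > 0"
begin

lemma linear_right: "linear (B x)"
proof -
  have "B x = (\<lambda>y. B y x)" by (rule ext) (rule commute)
  then show ?thesis using linear_left[of x] by simp
qed

lemma zero_left [simp]: "B 0 y = 0"
  and add_left: "B (x + x') y = B x y + B x' y"
  and diff_left: "B (x - x') y = B x y - B x' y"
  and scale_left: "B (c *\<^sub>R x) y = c * B x y"
  and sum_left: "B (\<Sum>i\<in>I. g i) y = (\<Sum>i\<in>I. B (g i) y)"
  by (simp_all only: linear_0[OF linear_left[of y]] linear_add[OF linear_left[of y]] linear_diff[OF linear_left[of y]]
      linear_scale[OF linear_left[of y]] linear_sum[OF linear_left[of y]] real_scaleR_def)

lemma zero_right [simp]: "B y 0 = 0"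
  and add_right: "B y (x + x') = B y x + B y x'"
  and diff_right: "B y (x - x') = B y x - B y x'"
  and scale_right: "B y (c *\<^sub>R x) = c * B y x"
  and sum_right: "B y (\<Sum>i\<in>I. g i) = (\<Sum>i\<in>I. B y (g i))"
  by (simp_all only: linear_0[OF linear_right[of y]] linear_add[OF linear_right[of y]] linear_diff[OF linear_right[of y]]
      linear_scale[OF linear_right[of y]] linear_sum[OF linear_right[of y]] real_scaleR_def)

lemma nonneg: "B x x \<ge> 0"
  by (cases "x = 0") (simp_all add: less_imp_le pos)

lemma orthogonal_span:
  assumes "\<And>f. f \<in> S \<Longrightarrow> B w f = 0" and "v \<in> span S"
  shows "B w v = 0"
  using assms(2)
  by (induction rule: span_induct_alt) (auto simp: add_right scale_right assms(1))

text \<open>Gram-Schmidt by induction on \<open>S\<close>, for all \<open>h\<close> at once, since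
  the induction hypothesis serves both \<open>h\<close> and the new vector \<open>f\<close>. If the
  residual \<open>f - p\<close> vanishes, the projection \<open>v\<close> of \<open>h\<close> stays
  valid; otherwise it is corrected along \<open>f - p\<close>.\<close>

lemma orthogonal_projection_exists:
  "finite S \<Longrightarrow> \<exists>v\<in>span S. \<forall>f\<in>S. B (h - v) f = 0"
proof (induction S arbitrary: h rule: finite_induct)
  case empty
  then show ?case by simp
next
  case (insert f S)
  from insert.IH[of f] obtain p where p: "p \<in> span S" "\<forall>g\<in>S. B (f - p) g = 0" by blast
  from insert.IH[of h] obtain v where v: "v \<in> span S" "\<forall>g\<in>S. B (h - v) g = 0" by blast
  have v': "v \<in> span (insert f S)" and p': "p \<in> span (insert f S)"
    using v(1) p(1) span_mono[of S "insert f S"] by auto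
  have f': "f \<in> span (insert f S)" by (simp add: span_base)
  let ?q = "f - p"
  have hp: "B (h - v) p = 0" by (rule orthogonal_span[OF _ p(1)]) (use v in auto)
  have qp: "B ?q p = 0" by (rule orthogonal_span[OF _ p(1)]) (use p in auto)
  show ?case
  proof (cases "?q = 0")
    case True
    then have "B (h - v) f = 0" using hp by simp
    then show ?thesis using v v' by (intro bexI[of _ v]) auto
  next
    case False
    then have q: "B ?q ?q \<noteq> 0" using pos[OF False] by simp
    let ?c = "B (h - v) ?q / B ?q ?q"
    have eq: "h - (v + ?c *\<^sub>R ?q) = (h - v) - ?c *\<^sub>R ?q" by simp
    have "B (h - (v + ?c *\<^sub>R ?q)) g = 0" if "g \<in> S" for g
      using v p that unfolding eq by (simp add: diff_left[of "h - v"] scale_left)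
    moreover have "B (h - (v + ?c *\<^sub>R ?q)) f = 0"
    proof -
      have "B (h - (v + ?c *\<^sub>R ?q)) ?q = 0" "B (h - (v + ?c *\<^sub>R ?q)) p = 0"
        unfolding eq using q hp qp by (simp_all add: diff_left[of "h - v"] scale_left)
      then show ?thesis by (simp add: diff_right)
    qed
    moreover have "v + ?c *\<^sub>R ?q \<in> span (insert f S)"
      using v' f' p' by (intro span_add span_scale span_diff)
    ultimately show ?thesis by (intro bexI[of _ "v + ?c *\<^sub>R ?q"]) auto
  qed
qed

section \<open>Gram matrices and approximation from sampled spans\<close>

definition gram_mat :: "'f list \<Rightarrow> real mat" where
  "gram_mat fs = mat (length fs) (length fs) (\<lambda>(i, j). B (fs ! i) (fs ! j))"

text \<open>The same orthogonal matrix \<open>u\<close> carries the \<open>fs ! i\<close> to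
  orthogonal vectors \<open>e k\<close> and back. The \<open>e k\<close> are eigenvectors of the sum
  of the operators \<open>f \<otimes> f\<close> over \<open>fs\<close>, left unnormalized: their
  squared length is the eigenvalue, so a zero eigenvalue forces \<open>e k = 0\<close>. As
  \<open>k\<close> counts from 0, its eigenvalue is \<open>lam (Suc k)\<close>.\<close>

lemma gram_eigenvectors:
  fixes fs :: "'f list"
  defines "R \<equiv> length fs" and "lam \<equiv> eig_desc (gram_mat fs)"
  obtains e :: "nat \<Rightarrow> 'f" and u :: "nat \<Rightarrow> nat \<Rightarrow> real" where
    "\<And>j k. j < R \<Longrightarrow> k < R \<Longrightarrow> (\<Sum>i<R. u i j * u i k) = (if j = k then 1 else 0)"
    "\<And>i l. i < R \<Longrightarrow> l < R \<Longrightarrow> (\<Sum>j<R. u i j * u l j) = (if i = l then 1 else 0)"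
    "\<And>i. i < R \<Longrightarrow> fs ! i = (\<Sum>k<R. u i k *\<^sub>R e k)"
    "\<And>j k. j < R \<Longrightarrow> k < R \<Longrightarrow> B (e j) (e k) = (if j = k then lam (Suc k) else 0)"
    "\<And>i j. i \<le> j \<Longrightarrow> j < R \<Longrightarrow> lam (Suc j) \<le> lam (Suc i)"
    "\<And>k. k < R \<Longrightarrow> 0 \<le> lam (Suc k)"
    "\<And>k. k < R \<Longrightarrow> lam (Suc k) = 0 \<Longrightarrow> e k = 0"
proof -
  have G: "gram_mat fs \<in> carrier_mat R R" by (simp add: gram_mat_def R_def)
  have GT: "(gram_mat fs)\<^sup>T = gram_mat fs"
    by (rule eq_matI) (auto simp: gram_mat_def commute)
  obtain u :: "nat \<Rightarrow> nat \<Rightarrow> real" where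
    u1: "\<And>j k. j < R \<Longrightarrow> k < R \<Longrightarrow> (\<Sum>i<R. u i j * u i k) = (if j = k then 1 else 0)" and
    u2: "\<And>i l. i < R \<Longrightarrow> l < R \<Longrightarrow> (\<Sum>j<R. u i j * u l j) = (if i = l then 1 else 0)" and
    Gu: "\<And>i k. i < R \<Longrightarrow> k < R \<Longrightarrow> (\<Sum>l<R. gram_mat fs $$ (i, l) * u l k) = lam (Suc k) * u i k" and
    mono: "\<And>i j. i \<le> j \<Longrightarrow> j < R \<Longrightarrow> lam (Suc j) \<le> lam (Suc i)"
    apply (rule symmetric_mat_eigenbasis[OF G GT, folded lam_def])
    subgoal premises prems by (rule prems(1)[OF prems(2-)])
    done
  define e where "e k = (\<Sum>i<R. u i k *\<^sub>R (fs ! i))" for k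
  have fs: "fs ! i = (\<Sum>k<R. u i k *\<^sub>R e k)" if i: "i < R" for i
  proof -
    have "(\<Sum>k<R. u i k *\<^sub>R e k) = (\<Sum>k<R. \<Sum>l<R. (u i k * u l k) *\<^sub>R (fs ! l))"
      by (simp add: e_def scaleR_sum_right)
    also have "\<dots> = (\<Sum>l<R. (\<Sum>k<R. u i k * u l k) *\<^sub>R (fs ! l))"
      by (subst sum.swap) (simp add: scaleR_sum_left)
    also have "\<dots> = (\<Sum>l<R. if l = i then fs ! l else 0)"
      using u2 i by (intro sum.cong) auto
    finally show ?thesis using i by simp
  qed
  have fe: "B (fs ! i) (e k) = lam (Suc k) * u i k" if "i < R" "k < R" for i k
  proof -
    have "B (fs ! i) (e k) = (\<Sum>l<R. gram_mat fs $$ (i, l) * u l k)"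
      using that by (simp add: e_def sum_right scale_right gram_mat_def R_def mult.commute)
    then show ?thesis using Gu that by simp
  qed
  have ee: "B (e j) (e k) = (if j = k then lam (Suc k) else 0)" if "j < R" "k < R" for j k
  proof -
    have "B (e j) (e k) = (\<Sum>i<R. u i j * (lam (Suc k) * u i k))"
      using that by (subst e_def) (simp add: sum_left scale_left fe)
    also have "\<dots> = lam (Suc k) * (\<Sum>i<R. u i j * u i k)" by (simp add: sum_distrib_left mult_ac)
    finally show ?thesis using u1 that by simp
  qed
  show ?thesis
  proof (rule that[OF u1 u2 fs ee mono])
    fix k assume k: "k < R"
    show "0 \<le> lam (Suc k)" using nonneg[of "e k"] ee[OF k k] by simp
    show "e k = 0" if "lam (Suc k) = 0" using pos[of "e k"] ee[OF k k] that by auto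
  qed
qed

text \<open>
  \<open>Z x\<close> is the matrix of the operator \<open>\<Sum>f\<in>F x. f \<otimes> f\<close> in the orthonormal basis of normalized
  eigenvectors, so that the norm of \<open>Z\<close> over \<open>J\<close> is the Hilbert-Schmidt norm. The residual
  \<open>w = h - v\<close> is annihilated by the operators of the sampled points, so that
  the full operator acts on \<open>w\<close> as the sampling error does.
\<close>

theorem sampled_span_approximation:
  fixes F :: "'x \<Rightarrow> 'f list" and xs :: "'x list"
  defines "fs \<equiv> concat (map F xs)"
  defines "R \<equiv> length fs" and "lam \<equiv> eig_desc (gram_mat fs)"
  obtains J :: "(nat \<times> nat) set" and Z :: "'x \<Rightarrow> nat \<times> nat \<Rightarrow> real" where
    "finite J"
    "\<And>x. x \<in> set xs \<Longrightarrow> L2_set (Z x) J \<le> (\<Sum>f\<leftarrow>F x. B f f)"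
    "\<And>r. 0 \<le> lam r"
    "\<And>ys c \<beta> r. 1 \<le> r \<Longrightarrow> r \<le> R \<Longrightarrow> 0 < lam r \<Longrightarrow> set ys \<subseteq> set xs \<Longrightarrow>
       \<exists>v\<in>span (\<Union>y\<in>set ys. set (F y)).
         B ((\<Sum>i<R. \<beta> i *\<^sub>R (fs ! i)) - v) ((\<Sum>i<R. \<beta> i *\<^sub>R (fs ! i)) - v)
         \<le> (\<Sum>i<R. (\<beta> i)\<^sup>2) *
            ((L2_set (\<lambda>j. (\<Sum>x\<leftarrow>xs. Z x j) - c * (\<Sum>y\<leftarrow>ys. Z y j)) J)\<^sup>2 / lam r + lam (r + 1))"
proof -
  obtain e u where
    u1: "\<And>j k. j < R \<Longrightarrow> k < R \<Longrightarrow> (\<Sum>i<R. u i j * u i k) = (if j = k then 1 else 0)" and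
    u2: "\<And>i l. i < R \<Longrightarrow> l < R \<Longrightarrow> (\<Sum>j<R. u i j * u l j) = (if i = l then 1 else 0)" and
    fs: "\<And>i. i < R \<Longrightarrow> fs ! i = (\<Sum>k<R. u i k *\<^sub>R e k)" and
    ee: "\<And>j k. j < R \<Longrightarrow> k < R \<Longrightarrow> B (e j) (e k) = (if j = k then lam (Suc k) else 0)" and
    mono: "\<And>i j. i \<le> j \<Longrightarrow> j < R \<Longrightarrow> lam (Suc j) \<le> lam (Suc i)" and
    lam0: "\<And>k. k < R \<Longrightarrow> 0 \<le> lam (Suc k)" and
    e0: "\<And>k. k < R \<Longrightarrow> lam (Suc k) = 0 \<Longrightarrow> e k = 0"
    apply (rule gram_eigenvectors[of fs, folded R_def lam_def])
    subgoal premises prems by (rule prems(1)[OF prems(2-)])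
    done
  \<comment> \<open>Only positive eigenvalues allow normalization. For the other indices
    \<open>e k = 0\<close>, so sums over all \<open>k\<close> restrict to \<open>P\<close>.\<close>
  define P where "P = {k. k < R \<and> 0 < lam (Suc k)}"
  have P: "finite P" "\<And>k. k \<in> P \<Longrightarrow> k < R" "\<And>k. k \<in> P \<Longrightarrow> 0 < lam (Suc k)" by (auto simp: P_def)
  have sum_P: "(\<Sum>k<R. g k) = (\<Sum>k\<in>P. g k)" if "\<And>k. k < R \<Longrightarrow> lam (Suc k) = 0 \<Longrightarrow> g k = 0"
    for g :: "nat \<Rightarrow> 'c::comm_monoid_add"
    by (rule sum.mono_neutral_right) (use that lam0 in \<open>force simp: P_def\<close>)+
  \<comment> \<open>The coordinate of \<open>f\<close> along the normalized eigenvector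
    \<open>e k / sqrt (lam (Suc k))\<close>.\<close>
  define a where "a f k = B f (e k) / sqrt (lam (Suc k))" for f k
  define Z where "Z x = (\<lambda>(j, k). \<Sum>f\<leftarrow>F x. a f j * a f k)" for x
  have e_fs: "e k = (\<Sum>i<R. u i k *\<^sub>R (fs ! i))" if k: "k < R" for k
  proof -
    have "(\<Sum>i<R. u i k *\<^sub>R (fs ! i)) = (\<Sum>i<R. \<Sum>l<R. (u i k * u i l) *\<^sub>R e l)"
      by (simp add: fs scaleR_sum_right)
    also have "\<dots> = (\<Sum>l<R. (\<Sum>i<R. u i k * u i l) *\<^sub>R e l)"
      by (subst sum.swap) (simp add: scaleR_sum_left)
    also have "\<dots> = (\<Sum>l<R. if l = k then e l else 0)"
      using u1 k by (intro sum.cong) auto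
    finally show ?thesis using k by simp
  qed
  have fe: "B (fs ! i) (e k) = lam (Suc k) * u i k" if "i < R" "k < R" for i k
  proof -
    have "B (fs ! i) (e k) = (\<Sum>j<R. u i j * B (e j) (e k))"
      using that(1) by (simp add: fs sum_left scale_left)
    also have "\<dots> = (\<Sum>j<R. if j = k then lam (Suc k) * u i k else 0)"
      using that by (intro sum.cong) (auto simp: ee)
    finally show ?thesis using that by simp
  qed
  have in_fs: "\<exists>i<R. f = fs ! i" if "x \<in> set xs" "f \<in> set (F x)" for x f
  proof -
    have "f \<in> set fs" using that by (auto simp: fs_def)
    then show ?thesis by (auto simp: in_set_conv_nth R_def)
  qed
  have span_e: "\<exists>c. f = (\<Sum>k<R. c k *\<^sub>R e k)" if "f \<in> span (set fs)" for f
    using that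
  proof (induction rule: span_induct_alt)
    case base
    show ?case by (rule exI[of _ "\<lambda>_. 0"]) simp
  next
    case (step a x y)
    then obtain i c where i: "i < R" "x = fs ! i" and c: "y = (\<Sum>k<R. c k *\<^sub>R e k)"
      by (auto simp: in_set_conv_nth R_def)
    show ?case
      by (rule exI[of _ "\<lambda>k. a * u i k + c k"])
        (simp add: i c fs[OF i(1)] scaleR_add_left sum.distrib scaleR_sum_right)
  qed
  \<comment> \<open>Parseval's identity. The span condition concerns \<open>f\<close> only, as the
    part of \<open>g\<close> orthogonal to the span contributes to neither side.\<close>
  have expand: "B g f = (\<Sum>k\<in>P. a g k * a f k)" if f: "f \<in> span (set fs)" for g f
  proof -
    obtain c where c: "f = (\<Sum>k<R. c k *\<^sub>R e k)" using span_e[OF f] by blast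
    have fek: "B f (e k) = c k * lam (Suc k)" if "k < R" for k
    proof -
      have "B f (e k) = (\<Sum>j<R. c j * B (e j) (e k))" by (simp add: c sum_left scale_left)
      also have "\<dots> = (\<Sum>j<R. if j = k then c k * lam (Suc k) else 0)"
        using that by (intro sum.cong) (auto simp: ee)
      finally show ?thesis using that by simp
    qed
    have "B g f = (\<Sum>k<R. c k * B g (e k))" by (simp add: c sum_right scale_right)
    also have "\<dots> = (\<Sum>k\<in>P. c k * B g (e k))" by (rule sum_P) (simp add: e0)
    also have "\<dots> = (\<Sum>k\<in>P. a g k * a f k)"
    proof (rule sum.cong[OF refl])
      fix k assume "k \<in> P"
      then have "k < R" "0 < lam (Suc k)" using P by auto
      then show "c k * B g (e k) = a g k * a f k" by (simp add: a_def fek)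
    qed
    finally show ?thesis .
  qed
  have fs_span: "fs ! i \<in> span (set fs)" if "i < R" for i
    using that by (intro span_base) (simp add: R_def)
  show ?thesis
  proof (rule that[of "P \<times> P" Z])
    show "finite (P \<times> P)" using P by simp
  next
    fix x assume x: "x \<in> set xs"
    \<comment> \<open>The operator \<open>f \<otimes> f\<close> has Hilbert-Schmidt norm
      \<open>B f f\<close>, and the triangle inequality sums these norms over the list.\<close>
    have "L2_set (\<lambda>p. \<Sum>f\<leftarrow>gs. a f (fst p) * a f (snd p)) (P \<times> P) \<le> (\<Sum>f\<leftarrow>gs. B f f)"
      if "set gs \<subseteq> set (F x)" for gs
      using that
    proof (induction gs)
      case Nil
      then show ?case by (simp add: L2_set_def)
    next
      case (Cons f gs)
      then obtain i where i: "i < R" "f = fs ! i" using in_fs[OF x, of f] by auto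
      have "L2_set (\<lambda>p. a f (fst p) * a f (snd p)) (P \<times> P)
          = sqrt ((\<Sum>j\<in>P. (a f j)\<^sup>2) * (\<Sum>k\<in>P. (a f k)\<^sup>2))"
        by (simp add: L2_set_def power_mult_distrib sum_product sum.cartesian_product case_prod_beta)
      also have "\<dots> = B f f"
        using expand[of f f] fs_span[OF i(1)] i(2) nonneg[of f] by (simp add: power2_eq_square)
      finally have *: "L2_set (\<lambda>p. a f (fst p) * a f (snd p)) (P \<times> P) = B f f" .
      show ?case
        using L2_set_triangle_ineq[of "\<lambda>p. a f (fst p) * a f (snd p)"
            "\<lambda>p. \<Sum>f\<leftarrow>gs. a f (fst p) * a f (snd p)" "P \<times> P"] * Cons by simp
    qed
    from this[of "F x"] show "L2_set (Z x) (P \<times> P) \<le> (\<Sum>f\<leftarrow>F x. B f f)"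
      by (simp add: Z_def case_prod_unfold)
  next
    show lam_nonneg: "0 \<le> lam r" for r
    proof (cases "1 \<le> r \<and> r \<le> R")
      case True
      then show ?thesis using lam0 by (cases r) auto
    next
      case False
      then show ?thesis by (auto simp: lam_def eig_desc_def gram_mat_def R_def)
    qed
    fix ys c \<beta> r
    assume r: "1 \<le> r" "r \<le> R" "0 < lam r" and ys: "set ys \<subseteq> set xs"
    let ?h = "\<Sum>i<R. \<beta> i *\<^sub>R (fs ! i)"
    define S where "S = (\<Union>y\<in>set ys. set (F y))"
    define Err where "Err p = (\<Sum>x\<leftarrow>xs. Z x p) - c * (\<Sum>y\<leftarrow>ys. Z y p)" for p
    define eps where "eps = L2_set Err (P \<times> P)"
    obtain v where v: "v \<in> span S" "\<forall>f\<in>S. B (?h - v) f = 0"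
      using orthogonal_projection_exists[of S ?h] by (auto simp: S_def)
    define w where "w = ?h - v"
    have "S \<subseteq> set fs" using ys by (auto simp: S_def fs_def)
    then have "w \<in> span (set fs)"
      unfolding w_def using v(1) span_mono fs_span
      by (intro span_diff span_sum span_scale) auto
    note expand_w = expand[OF this]
    have Zw: "(\<Sum>k\<in>P. (\<Sum>x\<leftarrow>zs. Z x (j, k)) * a w k) = (\<Sum>f\<leftarrow>concat (map F zs). a f j * B f w)" for zs j
    proof -
      have 1: "(\<Sum>x\<leftarrow>zs. Z x (j, k)) = (\<Sum>f\<leftarrow>concat (map F zs). a f j * a f k)" for k
        by (induction zs) (simp_all add: Z_def)
      have "(\<Sum>k\<in>P. (\<Sum>f\<leftarrow>gs. a f j * a f k) * a w k) = (\<Sum>f\<leftarrow>gs. a f j * B f w)" for gs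
        by (induction gs) (simp_all add: expand_w sum.distrib distrib_right sum_distrib_left mult.assoc)
      then show ?thesis by (simp add: 1)
    qed
    have e_w: "(\<Sum>i<R. u i k * B (fs ! i) w) = B (e k) w" if "k < R" for k
      by (subst e_fs[OF that]) (simp add: sum_left scale_left)
    \<comment> \<open>The sampled operators contribute 0 because \<open>w\<close> is orthogonal to
      \<open>S\<close>, and the full operator is diagonal in this basis. Hence the error matrix
      multiplies the coordinates of \<open>w\<close> by the eigenvalues.\<close>
    have Err_w: "(\<Sum>k\<in>P. Err (j, k) * a w k) = lam (Suc j) * a w j" if j: "j \<in> P" for j
    proof -
      have "(\<Sum>f\<leftarrow>gs. a f j * B f w) = 0" if "set gs \<subseteq> S" for gs
        using that v(2) by (induction gs) (auto simp: w_def commute)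
      then have "(\<Sum>f\<leftarrow>concat (map F ys). a f j * B f w) = 0" by (simp add: S_def)
      moreover have "(\<Sum>f\<leftarrow>concat (map F xs). a f j * B f w) = (\<Sum>i<R. a (fs ! i) j * B (fs ! i) w)"
        by (simp add: fs_def[symmetric] sum_list_sum_nth R_def lessThan_atLeast0)
      moreover have "\<dots> = (\<Sum>i<R. sqrt (lam (Suc j)) * (u i j * B (fs ! i) w))"
        using P(2,3)[OF j] by (intro sum.cong) (auto simp: a_def fe real_div_sqrt field_simps)
      moreover have "\<dots> = sqrt (lam (Suc j)) * B (e j) w"
        using e_w P(2)[OF j] by (simp flip: sum_distrib_left)
      moreover have "\<dots> = lam (Suc j) * a w j"
        using P(3)[OF j] by (simp add: a_def commute[of w] real_div_sqrt field_simps)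
      moreover have "(\<Sum>k\<in>P. Err (j, k) * a w k)
          = (\<Sum>k\<in>P. (\<Sum>x\<leftarrow>xs. Z x (j, k)) * a w k) - c * (\<Sum>k\<in>P. (\<Sum>y\<leftarrow>ys. Z y (j, k)) * a w k)"
        by (simp add: Err_def left_diff_distrib sum_subtractf sum_distrib_left mult.assoc)
      ultimately show ?thesis by (simp add: Zw)
    qed
    have ww: "B w w = (\<Sum>k\<in>P. (a w k)\<^sup>2)" using expand_w[of w] by (simp add: power2_eq_square)
    \<comment> \<open>Cauchy-Schwarz in each row: the Hilbert-Schmidt norm dominates the operator
      norm.\<close>
    have "(\<Sum>j\<in>P. (lam (Suc j) * a w j)\<^sup>2) \<le> (\<Sum>j\<in>P. (\<Sum>k\<in>P. (Err (j, k))\<^sup>2) * B w w)"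
      unfolding ww by (intro sum_mono) (auto simp flip: Err_w intro: Cauchy_Schwarz_ineq_sum)
    also have "\<dots> = eps\<^sup>2 * B w w"
      by (simp add: eps_def L2_set_def sum_nonneg sum.cartesian_product case_prod_beta flip: sum_distrib_right)
    finally have main: "(\<Sum>j\<in>P. (lam (Suc j) * a w j)\<^sup>2) \<le> eps\<^sup>2 * B w w" .
    \<comment> \<open>As \<open>k\<close> counts from 0, the \<open>r\<close> largest eigenvalues
      are those with \<open>k < r\<close>, and they are at least \<open>lam r\<close>. The others
      are at most \<open>lam (r + 1)\<close>; for \<open>r = R\<close> there are none, in accordance
      with the value 0 beyond the size of the matrix.\<close>
    have lam_split: "lam (Suc k) * (a w k)\<^sup>2 \<le> (lam (Suc k) * a w k)\<^sup>2 / lam r + lam (r + 1) * (a w k)\<^sup>2"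
      if k: "k \<in> P" for k
    proof (cases "k < r")
      case True
      then have "lam r \<le> lam (Suc k)" using mono[of k "r - 1"] r by simp
      then have "lam r * (lam (Suc k) * (a w k)\<^sup>2) \<le> lam (Suc k) * (lam (Suc k) * (a w k)\<^sup>2)"
        using P(3)[OF k] by (intro mult_right_mono) auto
      then have "lam (Suc k) * (a w k)\<^sup>2 \<le> (lam (Suc k) * a w k)\<^sup>2 / lam r"
        using r(3) by (simp add: pos_le_divide_eq power2_eq_square mult_ac)
      moreover have "0 \<le> lam (r + 1) * (a w k)\<^sup>2" using lam_nonneg by simp
      ultimately show ?thesis by simp
    next
      case False
      then have "lam (Suc k) \<le> lam (r + 1)" using mono[of r k] P(2)[OF k] by simp
      then have "lam (Suc k) * (a w k)\<^sup>2 \<le> lam (r + 1) * (a w k)\<^sup>2" by (intro mult_right_mono) auto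
      moreover have "0 \<le> (lam (Suc k) * a w k)\<^sup>2 / lam r" using r(3) by simp
      ultimately show ?thesis by simp
    qed
    define X where "X = eps\<^sup>2 / lam r + lam (r + 1)"
    \<comment> \<open>The left side is the quadratic form of the full operator at \<open>w\<close>.
      Orthogonality of \<open>u\<close> moves it to the eigenbasis, where the eigenvalues appear as
      weights.\<close>
    have "(\<Sum>i<R. (B (fs ! i) w)\<^sup>2) = (\<Sum>i<R. \<Sum>k<R. u i k * B (fs ! i) w * B (e k) w)"
      by (simp add: fs sum_left scale_left power2_eq_square sum_distrib_left sum_distrib_right mult_ac)
    also have "\<dots> = (\<Sum>k<R. (\<Sum>i<R. u i k * B (fs ! i) w) * B (e k) w)"
      by (subst sum.swap) (simp add: sum_distrib_right)
    also have "\<dots> = (\<Sum>k<R. (B (e k) w)\<^sup>2)" by (simp add: e_w power2_eq_square)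
    also have "\<dots> = (\<Sum>k\<in>P. (B (e k) w)\<^sup>2)" by (rule sum_P) (simp add: e0)
    also have "\<dots> = (\<Sum>k\<in>P. lam (Suc k) * (a w k)\<^sup>2)"
    proof (rule sum.cong[OF refl])
      fix k assume "k \<in> P"
      then have "0 < lam (Suc k)" using P by auto
      then show "(B (e k) w)\<^sup>2 = lam (Suc k) * (a w k)\<^sup>2"
        by (simp add: a_def commute[of w] power_divide)
    qed
    also have "\<dots> \<le> (\<Sum>k\<in>P. (lam (Suc k) * a w k)\<^sup>2 / lam r + lam (r + 1) * (a w k)\<^sup>2)"
      by (intro sum_mono lam_split)
    also have "\<dots> = (\<Sum>k\<in>P. (lam (Suc k) * a w k)\<^sup>2) / lam r + lam (r + 1) * B w w"
      by (simp add: ww sum.distrib sum_divide_distrib sum_distrib_left)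
    also have "\<dots> \<le> eps\<^sup>2 * B w w / lam r + lam (r + 1) * B w w"
      using main r(3) by (simp add: divide_right_mono)
    also have "\<dots> = X * B w w" by (simp add: X_def algebra_simps)
    finally have fw: "(\<Sum>i<R. (B (fs ! i) w)\<^sup>2) \<le> X * B w w" .
    \<comment> \<open>As \<open>w\<close> is orthogonal to \<open>v\<close>, its squared length
      equals \<open>B ?h w\<close>, which is linear in \<open>\<beta>\<close>. Cauchy-Schwarz
      separates \<open>\<beta>\<close> from the pairings bounded above, and one factor
      \<open>B w w\<close> cancels at the end.\<close>
    have "B w v = 0" using orthogonal_span[of S w v] v by (auto simp: w_def)
    then have "B w w = B ?h w"
      by (simp add: w_def diff_left[of ?h] commute[of _ v])
    also have "\<dots> = (\<Sum>i<R. \<beta> i * B (fs ! i) w)" by (simp add: sum_left scale_left)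
    finally have "(B w w)\<^sup>2 \<le> (\<Sum>i<R. (\<beta> i)\<^sup>2) * (\<Sum>i<R. (B (fs ! i) w)\<^sup>2)"
      by (simp add: Cauchy_Schwarz_ineq_sum)
    also have "\<dots> \<le> (\<Sum>i<R. (\<beta> i)\<^sup>2) * (X * B w w)" using fw by (intro mult_left_mono sum_nonneg) auto
    finally have sq: "B w w * B w w \<le> (\<Sum>i<R. (\<beta> i)\<^sup>2) * X * B w w" by (simp add: power2_eq_square mult_ac)
    have X0: "0 \<le> (\<Sum>i<R. (\<beta> i)\<^sup>2) * X"
      using r(3) lam_nonneg by (simp add: X_def sum_nonneg)
    have "B w w \<le> (\<Sum>i<R. (\<beta> i)\<^sup>2) * X"
    proof (cases "B w w = 0")
      case True
      then show ?thesis using X0 by simp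
    next
      case False
      then have "0 < B w w" using nonneg[of w] by simp
      then show ?thesis using sq by simp
    qed
    then show "\<exists>v\<in>span (\<Union>y\<in>set ys. set (F y)). B (?h - v) (?h - v) \<le> (\<Sum>i<R. (\<beta> i)\<^sup>2) *
        ((L2_set (\<lambda>j. (\<Sum>x\<leftarrow>xs. Z x j) - c * (\<Sum>y\<leftarrow>ys. Z y j)) (P \<times> P))\<^sup>2 / lam r + lam (r + 1))"
      using v(1) unfolding S_def w_def X_def eps_def Err_def by blast
  qed
qed

end

section \<open>Uniform sampling\<close>

lemma expectation_pmf_of_list_entries:
  fixes f :: "'a \<Rightarrow> real"
  assumes "xs \<noteq> []"
  shows "measure_pmf.expectation (pmf_of_multiset (mset xs)) f = (\<Sum>x\<leftarrow>xs. f x) / length xs"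
proof -
  \<comment> \<open>The range \<open>A\<close> stays fixed and may exceed \<open>set ys\<close>, so
    that the induction over the list leaves the index set alone. Repeated entries count with their
    multiplicity.\<close>
  have count: "(\<Sum>x\<in>A. f x * count (mset ys) x) = (\<Sum>x\<leftarrow>ys. f x)"
    if "finite A" "set ys \<subseteq> A" for A ys
    using that(2)
  proof (induction ys)
    case (Cons y ys)
    have "(\<Sum>x\<in>A. f x * count (mset (y # ys)) x)
        = (\<Sum>x\<in>A. f x * count (mset ys) x + (if x = y then f y else 0))"
      by (intro sum.cong) (auto simp: algebra_simps)
    then show ?case using Cons that(1) by (simp add: sum.distrib)
  qed simp
  have "measure_pmf.expectation (pmf_of_multiset (mset xs)) f
      = (\<Sum>x\<in>set xs. f x * pmf (pmf_of_multiset (mset xs)) x)"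
    by (rule integral_measure_pmf_real) (use assms in auto)
  also have "\<dots> = (\<Sum>x\<in>set xs. f x * count (mset xs) x) / length xs"
    using assms by (simp add: sum_divide_distrib)
  finally show ?thesis by (simp add: count)
qed

text \<open>Subtracting the mean at most doubles the bound, so concentration applies with
  \<open>c = 2 * C0\<close> and \<open>l = ln (2 / \<delta>)\<close>, whose failure probability is
  \<open>exp (- l) = \<delta> / 2\<close>. The constant 100 is \<open>(2 * 5)^2\<close>.\<close>

lemma uniform_sample_deviation:
  fixes Z :: "'x \<Rightarrow> 'j \<Rightarrow> real"
  assumes xs: "xs \<noteq> []" and J: "finite J" and C0: "0 < C0"
    and Z: "\<And>x. x \<in> set xs \<Longrightarrow> L2_set (Z x) J \<le> C0"
    and M: "0 < M" and \<delta>: "0 < \<delta>" "\<delta> < 1"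
  shows "measure_pmf.prob (uniform_sample M xs)
      {ys. set ys \<subseteq> set xs \<and>
        (L2_set (\<lambda>j. (\<Sum>x\<leftarrow>xs. Z x j) - (length xs / M) * (\<Sum>y\<leftarrow>ys. Z y j)) J)\<^sup>2
        \<le> 100 * C0\<^sup>2 * (real (length xs))\<^sup>2 * (ln (2 / \<delta>))\<^sup>2 / M} \<ge> 1 - \<delta> / 2"
    (is "measure_pmf.prob ?q ?Good \<ge> _")
proof -
  define N where "N = real (length xs)"
  have N: "0 < N" using xs by (simp add: N_def)
  define l where "l = ln (2 / \<delta>)"
  have "ln 2 \<le> l" unfolding l_def using \<delta> by (intro ln_mono) (auto simp: field_simps)
  \<comment> \<open>\<open>l \<ge> ln 2 \<ge> 2/3\<close> gives \<open>5/2 \<le> 4 * l\<close>, so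
    the threshold becomes a multiple of \<open>l\<close>.\<close>
  then have l: "5/2 + l \<le> 5 * l" "0 < l" using ln2_ge_two_thirds by simp_all
  let ?p = "pmf_of_multiset (mset xs)"
  define m where "m j = (\<Sum>x\<leftarrow>xs. Z x j) / N" for j
  define X where "X y j = Z y j - m j" for y j
  have set_p: "set_pmf ?p = set xs" using xs by simp
  have L2_m: "L2_set m J \<le> C0"
  proof -
    have "L2_set (\<lambda>j. \<Sum>x\<leftarrow>ys. Z x j) J \<le> C0 * length ys" if "set ys \<subseteq> set xs" for ys
      using that
    proof (induction ys)
      case (Cons y ys)
      then show ?case
        using L2_set_triangle_ineq[of "Z y" "\<lambda>j. \<Sum>x\<leftarrow>ys. Z x j" J] Z[of y]
        by (simp add: algebra_simps)
    qed (simp add: L2_set_def)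
    from this[of xs] have "L2_set (\<lambda>j. \<Sum>x\<leftarrow>xs. Z x j) J * (1 / N) \<le> C0"
      using N by (simp add: N_def field_simps)
    also have "L2_set (\<lambda>j. \<Sum>x\<leftarrow>xs. Z x j) J * (1 / N) = L2_set m J"
      using N by (subst L2_set_left_distrib) (auto simp: m_def[abs_def])
    finally show ?thesis .
  qed
  have X: "L2_set (X y) J \<le> 2 * C0" if "y \<in> set_pmf ?p" for y
  proof -
    have "L2_set (X y) J = L2_set (\<lambda>j. Z y j + - m j) J" by (simp add: X_def[abs_def])
    also have "\<dots> \<le> L2_set (Z y) J + L2_set (\<lambda>j. - m j) J" by (rule L2_set_triangle_ineq)
    also have "L2_set (\<lambda>j. - m j) J = L2_set m J" by (simp add: L2_set_def)
    finally show ?thesis using Z[of y] L2_m that set_p by simp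
  qed
  have mean: "measure_pmf.expectation ?p (\<lambda>y. X y j) = 0" for j
  proof -
    have "(\<Sum>x\<leftarrow>ys. X x j) = (\<Sum>x\<leftarrow>ys. Z x j) - length ys * m j" for ys
      by (induction ys) (simp_all add: X_def algebra_simps)
    from this[of xs] show ?thesis
      using N xs by (simp add: expectation_pmf_of_list_entries m_def N_def)
  qed
  define T where "T = {ys. L2_set (\<lambda>j. \<Sum>y\<leftarrow>ys. X y j) J > 2 * C0 * sqrt M * (5/2 + l)}"
  have "measure_pmf.prob ?q T \<le> exp (- l)"
    unfolding uniform_sample_def T_def
    by (rule sample_sum_concentration) (use J X mean C0 M set_p in auto)
  also have "exp (- l) = \<delta> / 2" using \<delta> by (simp add: l_def exp_minus)
  finally have "1 - \<delta> / 2 \<le> 1 - measure_pmf.prob ?q T" by simp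
  also have "\<dots> = measure_pmf.prob ?q (- T)"
    using measure_pmf.prob_compl[of T ?q] by (simp add: Compl_eq_Diff_UNIV)
  also have "\<dots> \<le> measure_pmf.prob ?q ?Good"
  proof (rule measure_pmf.finite_measure_mono_AE)
    show "AE ys in ?q. ys \<in> - T \<longrightarrow> ys \<in> ?Good"
    proof (rule AE_pmfI, rule impI)
      fix ys assume "ys \<in> set_pmf ?q" and nT: "ys \<in> - T"
      then have ys: "set ys \<subseteq> set xs" "length ys = M"
        using set_p by (auto simp: uniform_sample_def set_replicate_pmf)
      let ?S = "L2_set (\<lambda>j. \<Sum>y\<leftarrow>ys. X y j) J"
      have S: "?S \<le> 2 * C0 * sqrt M * (5 * l)"
      proof -
        have "?S \<le> 2 * C0 * sqrt M * (5/2 + l)" using nT by (simp add: T_def)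
        also have "\<dots> \<le> 2 * C0 * sqrt M * (5 * l)" using l C0 by (intro mult_left_mono) auto
        finally show ?thesis .
      qed
      have sumX: "(\<Sum>y\<leftarrow>zs. X y j) = (\<Sum>y\<leftarrow>zs. Z y j) - length zs * m j" for zs j
        by (induction zs) (simp_all add: X_def algebra_simps)
      \<comment> \<open>The sample contains the mean \<open>M\<close> times, and
        \<open>(N / M) * M * m j\<close> is the full sum, so only the centered terms remain.\<close>
      have Err: "(\<Sum>x\<leftarrow>xs. Z x j) - (N / M) * (\<Sum>y\<leftarrow>ys. Z y j) = - (N / M) * (\<Sum>y\<leftarrow>ys. X y j)" for j
        using N M ys by (simp add: sumX m_def field_simps)
      have "(L2_set (\<lambda>j. - (N / M) * (\<Sum>y\<leftarrow>ys. X y j)) J)\<^sup>2 = (N / M)\<^sup>2 * ?S\<^sup>2"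
        by (simp add: L2_set_def sum_nonneg power_mult_distrib power_divide sum_distrib_left)
      also have "\<dots> \<le> (N / M)\<^sup>2 * (2 * C0 * sqrt M * (5 * l))\<^sup>2"
        using S by (intro mult_left_mono power_mono) auto
      also have "\<dots> = 100 * C0\<^sup>2 * N\<^sup>2 * l\<^sup>2 / M"
        using M by (simp add: field_simps power2_eq_square)
      finally have "(L2_set (\<lambda>j. - (N / M) * (\<Sum>y\<leftarrow>ys. X y j)) J)\<^sup>2 \<le> 100 * C0\<^sup>2 * N\<^sup>2 * l\<^sup>2 / M" .
      then show "ys \<in> ?Good"
        unfolding mem_Collect_eq N_def[symmetric] l_def[symmetric] Err using ys(1) by blast
    qed
  qed simp
  finally show ?thesis .
qed

context inner_form
begin

text \<open>All \<open>r\<close> and \<open>\<beta>\<close> are quantified inside the event, since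
  every one of these bounds follows from the smallness of a single Hilbert-Schmidt deviation. With
  \<open>0 < M\<close> as a premise inside the event, the case \<open>M = 0\<close> is
  trivial.\<close>

theorem uniform_sample_span_approximation:
  fixes F :: "'x \<Rightarrow> 'f list" and xs :: "'x list"
  defines "fs \<equiv> concat (map F xs)"
  defines "lam \<equiv> eig_desc (gram_mat fs)"
  assumes xs: "xs \<noteq> []" and C0: "0 < C0"
    and trace: "\<And>x. x \<in> set xs \<Longrightarrow> (\<Sum>f\<leftarrow>F x. B f f) \<le> C0"
    and \<delta>: "0 < \<delta>" "\<delta> < 1"
  shows "measure_pmf.prob (uniform_sample M xs)
      {ys. \<forall>r\<in>{1..length fs}. \<forall>\<beta>. 0 < M \<longrightarrow> 0 < lam r \<longrightarrow> (\<Sum>i<length fs. (\<beta> i)\<^sup>2) \<le> 1 \<longrightarrow>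
        (\<exists>v\<in>span (\<Union>y\<in>set ys. set (F y)).
          B ((\<Sum>i<length fs. \<beta> i *\<^sub>R (fs ! i)) - v) ((\<Sum>i<length fs. \<beta> i *\<^sub>R (fs ! i)) - v)
          \<le> 100 * C0\<^sup>2 * (real (length xs))\<^sup>2 * (ln (2 / \<delta>))\<^sup>2 / (lam r * M) + lam (r + 1))}
     \<ge> 1 - \<delta> / 2" (is "measure_pmf.prob _ ?Good \<ge> _")
    and "0 \<le> lam r"
proof -
  let ?n = "length fs"
  let ?h = "\<lambda>\<beta>. \<Sum>i<length fs. \<beta> i *\<^sub>R (fs ! i)"
  obtain J :: "(nat \<times> nat) set" and Z where
    J: "finite J" and
    Z: "\<And>x. x \<in> set xs \<Longrightarrow> L2_set (Z x) J \<le> (\<Sum>f\<leftarrow>F x. B f f)" and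
    lam: "\<And>r. 0 \<le> lam r" and
    approx: "\<And>ys c \<beta> r. 1 \<le> r \<Longrightarrow> r \<le> ?n \<Longrightarrow> 0 < lam r \<Longrightarrow> set ys \<subseteq> set xs \<Longrightarrow>
       \<exists>v\<in>span (\<Union>y\<in>set ys. set (F y)). B (?h \<beta> - v) (?h \<beta> - v) \<le> (\<Sum>i<?n. (\<beta> i)\<^sup>2) *
         ((L2_set (\<lambda>j. (\<Sum>x\<leftarrow>xs. Z x j) - c * (\<Sum>y\<leftarrow>ys. Z y j)) J)\<^sup>2 / lam r + lam (r + 1))"
    apply (rule sampled_span_approximation[where F = F and xs = xs, folded fs_def, folded lam_def])
    subgoal premises prems by (rule prems(1)[OF prems(2-)])
    done
  show "0 \<le> lam r" by (rule lam)
  show "measure_pmf.prob (uniform_sample M xs) ?Good \<ge> 1 - \<delta> / 2"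
  proof (cases "0 < M")
    case False
    then show ?thesis using \<delta> by simp
  next
    case True
    let ?E = "100 * C0\<^sup>2 * (real (length xs))\<^sup>2 * (ln (2 / \<delta>))\<^sup>2 / M"
    let ?G = "{ys. set ys \<subseteq> set xs \<and>
        (L2_set (\<lambda>j. (\<Sum>x\<leftarrow>xs. Z x j) - (length xs / M) * (\<Sum>y\<leftarrow>ys. Z y j)) J)\<^sup>2 \<le> ?E}"
    have "1 - \<delta> / 2 \<le> measure_pmf.prob (uniform_sample M xs) ?G"
      using xs J C0 order_trans[OF Z trace] True \<delta> by (rule uniform_sample_deviation)
    also have "\<dots> \<le> measure_pmf.prob (uniform_sample M xs) ?Good"
    proof (rule measure_pmf.finite_measure_mono)
      show "?G \<subseteq> ?Good"
      proof (intro subsetI CollectI ballI allI impI)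
        fix ys r and \<beta> :: "nat \<Rightarrow> real"
        assume ys: "ys \<in> ?G" and r: "r \<in> {1..?n}" "0 < lam r" and \<beta>: "(\<Sum>i<?n. (\<beta> i)\<^sup>2) \<le> 1"
        let ?e = "(L2_set (\<lambda>j. (\<Sum>x\<leftarrow>xs. Z x j) - (length xs / M) * (\<Sum>y\<leftarrow>ys. Z y j)) J)\<^sup>2"
        obtain v where v: "v \<in> span (\<Union>y\<in>set ys. set (F y))"
          "B (?h \<beta> - v) (?h \<beta> - v) \<le> (\<Sum>i<?n. (\<beta> i)\<^sup>2) * (?e / lam r + lam (r + 1))"
          using approx[of r ys \<beta> "length xs / M"] r ys by auto
        have "(\<Sum>i<?n. (\<beta> i)\<^sup>2) * (?e / lam r + lam (r + 1)) \<le> 1 * (?e / lam r + lam (r + 1))"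
          using \<beta> r(2) lam by (intro mult_right_mono) auto
        also have "\<dots> \<le> ?E / lam r + lam (r + 1)"
          unfolding mult_1_left using ys r(2) by (intro add_right_mono divide_right_mono) auto
        also have "?E / lam r = 100 * C0\<^sup>2 * (real (length xs))\<^sup>2 * (ln (2 / \<delta>))\<^sup>2 / (lam r * M)"
          by (simp add: mult.commute)
        finally show "\<exists>v\<in>span (\<Union>y\<in>set ys. set (F y)). B (?h \<beta> - v) (?h \<beta> - v)
            \<le> 100 * C0\<^sup>2 * (real (length xs))\<^sup>2 * (ln (2 / \<delta>))\<^sup>2 / (lam r * M) + lam (r + 1)"
          using v by (intro bexI[of _ v]) auto
      qed
    qed simp
    finally show ?thesis .
  qed
qed

end

section \<open>Combination of the interior and boundary blocks\<close>

lemma prob_pair_pmf_ge: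
  assumes "measure_pmf.prob p {x. P x} \<ge> 1 - a" "measure_pmf.prob q {y. Q y} \<ge> 1 - b"
    and "\<And>x y. P x \<Longrightarrow> Q y \<Longrightarrow> (x, y) \<in> S"
  shows "measure_pmf.prob (pair_pmf p q) S \<ge> 1 - (a + b)"
proof -
  let ?pq = "pair_pmf p q"
  have 1: "measure_pmf.prob ?pq {z. P (fst z)} = measure_pmf.prob p {x. P x}"
    using measure_map_pmf[of fst ?pq "{x. P x}"] by (simp add: map_fst_pair_pmf vimage_def)
  have 2: "measure_pmf.prob ?pq {z. Q (snd z)} = measure_pmf.prob q {y. Q y}"
    using measure_map_pmf[of snd ?pq "{x. Q x}"] by (simp add: map_snd_pair_pmf vimage_def)
  have "measure_pmf.prob ?pq (- {z. P (fst z)} \<union> - {z. Q (snd z)})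
     \<le> measure_pmf.prob ?pq (- {z. P (fst z)}) + measure_pmf.prob ?pq (- {z. Q (snd z)})"
    by (rule measure_Un_le) auto
  also have "\<dots> \<le> a + b"
    using assms(1,2) measure_pmf.prob_compl[of "{z. P (fst z)}" ?pq]
      measure_pmf.prob_compl[of "{z. Q (snd z)}" ?pq] 1 2
    by (simp add: Compl_eq_Diff_UNIV)
  finally have "1 - (a + b) \<le> 1 - measure_pmf.prob ?pq (- {z. P (fst z)} \<union> - {z. Q (snd z)})" by simp
  also have "\<dots> = measure_pmf.prob ?pq (- (- {z. P (fst z)} \<union> - {z. Q (snd z)}))"
    using measure_pmf.prob_compl[of "- {z. P (fst z)} \<union> - {z. Q (snd z)}" ?pq]
    by (simp add: Compl_eq_Diff_UNIV)
  also have "\<dots> \<le> measure_pmf.prob ?pq S"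
    by (rule measure_pmf.finite_measure_mono) (use assms(3) in auto)
  finally show ?thesis .
qed

lemma covariance_inner_form:
  assumes "covariance_operator K"
  shows "inner_form (\<lambda>\<phi> \<psi>. blinfun_apply \<phi> (K \<psi>))"
proof (rule inner_form.intro)
  show "linear (\<lambda>\<phi>. blinfun_apply \<phi> (K \<psi>))" for \<psi>
    by (rule linearI) (simp_all add: blinfun.add_left blinfun.scaleR_left)
qed (use assms in \<open>auto simp: covariance_operator_def\<close>)

lemma norm_covariance_operator:
  assumes "covariance_operator K"
  shows "(norm (K \<phi>))\<^sup>2 = blinfun_apply \<phi> (K \<phi>)"
proof -
  have "bij K" "\<And>u. (norm u)\<^sup>2 = blinfun_apply (inv_into UNIV K u) u"
    using assms by (auto simp: covariance_operator_def)
  then show ?thesis by (simp add: bij_is_inj)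
qed

text \<open>The coefficients of \<open>h\<close> split into two vectors of norm at most 1, and
  \<open>K\<close> turns the form into the norm, so the approximations of the two parts add up. The
  factors 2 come from \<open>(x + y)^2 \<le> 2 * x^2 + 2 * y^2\<close>.\<close>

lemma approx_error_append_le:
  fixes K :: "('u::banach \<Rightarrow>\<^sub>L real) \<Rightarrow> 'u"
  assumes K: "covariance_operator K"
    and 1: "\<And>\<beta>. (\<Sum>i<length fs1. (\<beta> i)\<^sup>2) \<le> 1 \<Longrightarrow> \<exists>v\<in>span (set \<phi>1).
      blinfun_apply ((\<Sum>i<length fs1. \<beta> i *\<^sub>R (fs1 ! i)) - v) (K ((\<Sum>i<length fs1. \<beta> i *\<^sub>R (fs1 ! i)) - v)) \<le> E1"
    and 2: "\<And>\<beta>. (\<Sum>i<length fs2. (\<beta> i)\<^sup>2) \<le> 1 \<Longrightarrow> \<exists>v\<in>span (set \<phi>2).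
      blinfun_apply ((\<Sum>i<length fs2. \<beta> i *\<^sub>R (fs2 ! i)) - v) (K ((\<Sum>i<length fs2. \<beta> i *\<^sub>R (fs2 ! i)) - v)) \<le> E2"
  shows "approx_error (space_Ha K (\<phi>1 @ \<phi>2)) (space_Hb K (fs1 @ fs2)) \<le> ereal (2 * E1 + 2 * E2)"
  unfolding approx_error_def
proof (rule SUP_least)
  let ?n1 = "length fs1" and ?n2 = "length fs2"
  have lin: "linear K" using K by (simp add: covariance_operator_def)
  fix h assume "h \<in> space_Hb K (fs1 @ fs2)"
  then obtain \<beta> where h: "h = (\<Sum>j<?n1 + ?n2. \<beta> j *\<^sub>R K ((fs1 @ fs2) ! j))"
    and \<beta>: "L2_set \<beta> {..<?n1 + ?n2} \<le> 1"
    by (auto simp: space_Hb_def)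
  have split: "(\<Sum>j<m + n. g j) = (\<Sum>j<m. g j) + (\<Sum>j<n. g (m + j))"
    for g :: "nat \<Rightarrow> 'c::comm_monoid_add" and m n
    by (induction n) (simp_all add: add.assoc)
  define h1 where "h1 = (\<Sum>i<?n1. \<beta> i *\<^sub>R (fs1 ! i))"
  define h2 where "h2 = (\<Sum>i<?n2. \<beta> (?n1 + i) *\<^sub>R (fs2 ! i))"
  have h12: "h = K h1 + K h2"
    unfolding h split h1_def h2_def
    by (simp add: linear_sum[OF lin] linear_scale[OF lin] nth_append)
  have "(\<Sum>j<?n1 + ?n2. (\<beta> j)\<^sup>2) \<le> 1" using \<beta> by (simp add: L2_set_def)
  then have b: "(\<Sum>j<?n1. (\<beta> j)\<^sup>2) + (\<Sum>j<?n2. (\<beta> (?n1 + j))\<^sup>2) \<le> 1" by (simp add: split)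
  have nn: "0 \<le> (\<Sum>j<?n1. (\<beta> j)\<^sup>2)" "0 \<le> (\<Sum>j<?n2. (\<beta> (?n1 + j))\<^sup>2)" by (simp_all add: sum_nonneg)
  obtain v1 where v1: "v1 \<in> span (set \<phi>1)" "(norm (K (h1 - v1)))\<^sup>2 \<le> E1"
    using 1[of \<beta>] b nn unfolding norm_covariance_operator[OF K] h1_def by auto
  obtain v2 where v2: "v2 \<in> span (set \<phi>2)" "(norm (K (h2 - v2)))\<^sup>2 \<le> E2"
    using 2[of "\<lambda>j. \<beta> (?n1 + j)"] b nn unfolding norm_covariance_operator[OF K] h2_def by auto
  have "v1 + v2 \<in> span (set (\<phi>1 @ \<phi>2))"
    using v1(1) v2(1) span_mono[of "set \<phi>1" "set (\<phi>1 @ \<phi>2)"] span_mono[of "set \<phi>2" "set (\<phi>1 @ \<phi>2)"]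
    by (intro span_add) auto
  then have "K (v1 + v2) \<in> space_Ha K (\<phi>1 @ \<phi>2)"
    unfolding space_Ha_def set_map using linear_span_image[OF lin] by blast
  moreover have "(norm (K (v1 + v2) - h))\<^sup>2 \<le> 2 * E1 + 2 * E2"
  proof -
    have "K (v1 + v2) - h = - (K (h1 - v1) + K (h2 - v2))"
      by (simp add: h12 linear_add[OF lin] linear_diff[OF lin])
    then have "norm (K (v1 + v2) - h) \<le> norm (K (h1 - v1)) + norm (K (h2 - v2))"
      by (simp only: norm_minus_cancel norm_triangle_ineq)
    then have "(norm (K (v1 + v2) - h))\<^sup>2 \<le> (norm (K (h1 - v1)) + norm (K (h2 - v2)))\<^sup>2"
      by (intro power_mono) auto
    also have "\<dots> \<le> 2 * (norm (K (h1 - v1)))\<^sup>2 + 2 * (norm (K (h2 - v2)))\<^sup>2"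
      using zero_le_power2[of "norm (K (h1 - v1)) - norm (K (h2 - v2))"]
      by (simp add: power2_sum power2_diff)
    finally show ?thesis using v1 v2 by simp
  qed
  ultimately show "(INF v\<in>space_Ha K (\<phi>1 @ \<phi>2). ereal ((norm (v - h))\<^sup>2)) \<le> ereal (2 * E1 + 2 * E2)"
    by (intro INF_lower2[of "K (v1 + v2)"]) auto
qed

text \<open>\<open>C\<close> depends on \<open>C0\<close> alone, and \<open>r1\<close> and
  \<open>r2\<close> are quantified inside the event, so one draw serves all pairs with the same
  constant. The quotients are formed in the extended reals, where a positive number divided by 0 is
  infinite: a vanishing eigenvalue or a block without inducing points makes the bound
  infinite.\<close>

theorem theorem3p10:
  fixes C0 :: real
  assumes "C0 > 0"
  shows "\<exists>C>0. \<forall>(\<Omega> :: (real^'d) set) (val :: 'u::banach \<Rightarrow> real^'d \<Rightarrow> real) K Db D L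
            xs1 xs2 M1 M2 (\<delta>::real).
     gp_setting \<Omega> val K Db D L \<longrightarrow>
     set xs1 \<subseteq> \<Omega> \<longrightarrow>
     set xs2 \<subseteq> frontier \<Omega> \<longrightarrow>
     (\<forall>x\<in>set xs1. mat_trace (gram K (functionals L (Db+1) D [x]) (functionals L (Db+1) D [x])) \<le> C0) \<longrightarrow>
     (\<forall>x\<in>set xs2. mat_trace (gram K (functionals L 1 Db [x]) (functionals L 1 Db [x])) \<le> C0) \<longrightarrow>
     0 < \<delta> \<longrightarrow> \<delta> < 1 \<longrightarrow>
     (let psi1 = functionals L (Db+1) D xs1;
          psi2 = functionals L 1 Db xs2;
          lam = eig_desc (gram K psi1 psi1);
          tau = eig_desc (gram K psi2 psi2);
          N1 = real (length xs1);
          N2 = real (length xs2)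
      in measure_pmf.prob (pair_pmf (uniform_sample M1 xs1) (uniform_sample M2 xs2))
           {(ys1, ys2). \<forall>r1\<in>{1..length psi1}. \<forall>r2\<in>{1..length psi2}.
              approx_error
                (space_Ha K (functionals L (Db+1) D ys1 @ functionals L 1 Db ys2))
                (space_Hb K (psi1 @ psi2))
              \<le> max (ereal (C * N1^2 * (ln (2 / \<delta>))^2) / ereal (lam r1 * real M1))
                     (ereal (C * N2^2 * (ln (2 / \<delta>))^2) / ereal (tau r2 * real M2))
                + ereal (4 * lam (r1 + 1)) + ereal (4 * tau (r2 + 1))}
         \<ge> 1 - \<delta>)"
proof -
  \<comment> \<open>The factor 100 of the deviation bound, times 2 for splitting \<open>h\<close>
    into two blocks, times 2 for bounding a sum of two terms by twice their maximum.\<close>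
  define C where "C = 400 * C0\<^sup>2"
  have C: "C > 0" using assms by (simp add: C_def)
  show ?thesis
  proof (rule exI[of _ C], intro conjI C allI impI)
    fix \<Omega> :: "(real^'d) set" and val :: "'u \<Rightarrow> real^'d \<Rightarrow> real" and K and Db D :: nat
      and L xs1 xs2 and M1 M2 :: nat and \<delta> :: real
    assume gp: "gp_setting \<Omega> val K Db D L"
      and tr1: "\<forall>x\<in>set xs1. mat_trace (gram K (functionals L (Db+1) D [x]) (functionals L (Db+1) D [x])) \<le> C0"
      and tr2: "\<forall>x\<in>set xs2. mat_trace (gram K (functionals L 1 Db [x]) (functionals L 1 Db [x])) \<le> C0"
      and \<delta>: "0 < \<delta>" "\<delta> < 1"
    have K: "covariance_operator K" using gp by (simp add: gp_setting_def)
    interpret inner_form "\<lambda>\<phi> \<psi>. blinfun_apply \<phi> (K \<psi>)" by (rule covariance_inner_form[OF K])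
    let ?F1 = "\<lambda>x. functionals L (Db+1) D [x]"
    let ?F2 = "\<lambda>x. functionals L 1 Db [x]"
    let ?p1 = "functionals L (Db+1) D xs1"
    let ?p2 = "functionals L 1 Db xs2"
    define lam where "lam = eig_desc (gram K ?p1 ?p1)"
    define tau where "tau = eig_desc (gram K ?p2 ?p2)"
    have cat: "functionals L a b xs = concat (map (\<lambda>x. functionals L a b [x]) xs)" for a b xs
      by (simp add: functionals_def)
    have set_cat: "set (functionals L a b ys) = (\<Union>y\<in>set ys. set (functionals L a b [y]))" for a b ys
      by (subst cat) simp
    have gram: "gram K fs fs = gram_mat fs" for fs by (simp add: gram_def gram_mat_def)
    have trace: "mat_trace (gram K fs fs) = (\<Sum>f\<leftarrow>fs. blinfun_apply f (K f))" for fs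
      by (simp add: mat_trace_def gram_def sum_list_sum_nth lessThan_atLeast0)
    define a1 where "a1 r = 100 * C0\<^sup>2 * (real (length xs1))\<^sup>2 * (ln (2 / \<delta>))\<^sup>2 / (lam r * M1)" for r
    define a2 where "a2 r = 100 * C0\<^sup>2 * (real (length xs2))\<^sup>2 * (ln (2 / \<delta>))\<^sup>2 / (tau r * M2)" for r
    let ?h = "\<lambda>fs \<beta>. \<Sum>i<length fs. \<beta> i *\<^sub>R (fs ! i :: 'u \<Rightarrow>\<^sub>L real)"
    define P1 where "P1 ys1 \<longleftrightarrow> (\<forall>r\<in>{1..length ?p1}. \<forall>\<beta>. 0 < M1 \<longrightarrow> 0 < lam r \<longrightarrow>
      (\<Sum>i<length ?p1. (\<beta> i)\<^sup>2) \<le> 1 \<longrightarrow> (\<exists>v\<in>span (set (functionals L (Db+1) D ys1)).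
        blinfun_apply (?h ?p1 \<beta> - v) (K (?h ?p1 \<beta> - v)) \<le> a1 r + lam (r + 1)))" for ys1
    define P2 where "P2 ys2 \<longleftrightarrow> (\<forall>r\<in>{1..length ?p2}. \<forall>\<beta>. 0 < M2 \<longrightarrow> 0 < tau r \<longrightarrow>
      (\<Sum>i<length ?p2. (\<beta> i)\<^sup>2) \<le> 1 \<longrightarrow> (\<exists>v\<in>span (set (functionals L 1 Db ys2)).
        blinfun_apply (?h ?p2 \<beta> - v) (K (?h ?p2 \<beta> - v)) \<le> a2 r + tau (r + 1)))" for ys2
    define err where "err ys1 ys2 = approx_error
        (space_Ha K (functionals L (Db+1) D ys1 @ functionals L 1 Db ys2)) (space_Hb K (?p1 @ ?p2))" for ys1 ys2
    define rhs where "rhs r1 r2 = max (ereal (C * (real (length xs1))\<^sup>2 * (ln (2 / \<delta>))\<^sup>2) / ereal (lam r1 * real M1))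
        (ereal (C * (real (length xs2))\<^sup>2 * (ln (2 / \<delta>))\<^sup>2) / ereal (tau r2 * real M2))
        + ereal (4 * lam (r1 + 1)) + ereal (4 * tau (r2 + 1))" for r1 r2
    have "measure_pmf.prob (pair_pmf (uniform_sample M1 xs1) (uniform_sample M2 xs2))
        {(ys1, ys2). \<forall>r1\<in>{1..length ?p1}. \<forall>r2\<in>{1..length ?p2}. err ys1 ys2 \<le> rhs r1 r2} \<ge> 1 - \<delta>"
      (is "measure_pmf.prob ?q ?S \<ge> _")
    \<comment> \<open>If a block is empty, \<open>r1\<close> or \<open>r2\<close> has an empty range
      and the event is the whole space. Otherwise both samples are drawn from nonempty
      lists.\<close>
    proof (cases "?p1 = [] \<or> ?p2 = []")
      case True
      then have "?S = UNIV" by auto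
      then show ?thesis using \<delta> by simp
    next
      case False
      then have ne: "xs1 \<noteq> []" "xs2 \<noteq> []" by (auto simp: functionals_def)
      have "measure_pmf.prob (uniform_sample M xs)
          {ys. \<forall>r\<in>{1..length fs}. \<forall>\<beta>. 0 < M \<longrightarrow> 0 < eig_desc (gram K fs fs) r \<longrightarrow>
            (\<Sum>i<length fs. (\<beta> i)\<^sup>2) \<le> 1 \<longrightarrow> (\<exists>v\<in>span (set (functionals L a b ys)).
              blinfun_apply (?h fs \<beta> - v) (K (?h fs \<beta> - v))
              \<le> 100 * C0\<^sup>2 * (real (length xs))\<^sup>2 * (ln (2 / \<delta>))\<^sup>2 / (eig_desc (gram K fs fs) r * M)
                + eig_desc (gram K fs fs) (r + 1))} \<ge> 1 - \<delta> / 2"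
        and eig_nonneg: "0 \<le> eig_desc (gram K fs fs) r"
        if fs: "fs = functionals L a b xs" and xs: "xs \<noteq> []"
          and tr: "\<forall>x\<in>set xs. mat_trace (gram K (functionals L a b [x]) (functionals L a b [x])) \<le> C0"
        for a b xs fs r and M :: nat
      proof -
        have tr': "(\<Sum>f\<leftarrow>functionals L a b [x]. blinfun_apply f (K f)) \<le> C0" if "x \<in> set xs" for x
          using tr that by (simp add: trace)
        note approx = uniform_sample_span_approximation[where F = "\<lambda>x. functionals L a b [x]",
            OF xs assms tr' \<delta>, folded cat fs gram set_cat]
        show "measure_pmf.prob (uniform_sample M xs)
          {ys. \<forall>r\<in>{1..length fs}. \<forall>\<beta>. 0 < M \<longrightarrow> 0 < eig_desc (gram K fs fs) r \<longrightarrow>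
            (\<Sum>i<length fs. (\<beta> i)\<^sup>2) \<le> 1 \<longrightarrow> (\<exists>v\<in>span (set (functionals L a b ys)).
              blinfun_apply (?h fs \<beta> - v) (K (?h fs \<beta> - v))
              \<le> 100 * C0\<^sup>2 * (real (length xs))\<^sup>2 * (ln (2 / \<delta>))\<^sup>2 / (eig_desc (gram K fs fs) r * M)
                + eig_desc (gram K fs fs) (r + 1))} \<ge> 1 - \<delta> / 2"
          by (rule approx(1))
        show "0 \<le> eig_desc (gram K fs fs) r" by (rule approx(2))
      qed
      note block = this
      have 1: "measure_pmf.prob (uniform_sample M1 xs1) {ys. P1 ys} \<ge> 1 - \<delta> / 2"
        and lam: "0 \<le> lam r" for r
        unfolding P1_def a1_def lam_def using block[OF refl ne(1) tr1] by auto
      have 2: "measure_pmf.prob (uniform_sample M2 xs2) {ys. P2 ys} \<ge> 1 - \<delta> / 2"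
        and tau: "0 \<le> tau r" for r
        unfolding P2_def a2_def tau_def using block[OF refl ne(2) tr2] by auto
      have ln: "0 < ln (2 / \<delta>)" using \<delta> by simp
      have "err ys1 ys2 \<le> rhs r1 r2"
        if P1: "P1 ys1" and P2: "P2 ys2" and r1: "r1 \<in> {1..length ?p1}" and r2: "r2 \<in> {1..length ?p2}"
        for ys1 ys2 r1 r2
      proof (cases "0 < lam r1 * M1 \<and> 0 < tau r2 * M2")
        case False
        then have "lam r1 * M1 = 0 \<or> tau r2 * M2 = 0"
          using lam[of r1] tau[of r2] by (smt (verit) mult_nonneg_nonneg of_nat_0_le_iff)
        then have "rhs r1 r2 = \<infinity>"
          using C ln ne by (auto simp: rhs_def)
        then show ?thesis by simp
      next
        case True
        then have pos: "0 < lam r1" "0 < M1" "0 < tau r2" "0 < M2"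
          using lam[of r1] tau[of r2] by (auto simp: zero_less_mult_iff)
        have "err ys1 ys2 \<le> ereal (2 * (a1 r1 + lam (r1 + 1)) + 2 * (a2 r2 + tau (r2 + 1)))"
          unfolding err_def
          by (rule approx_error_append_le[OF K])
            (use P1 P2 r1 r2 pos in \<open>auto simp: P1_def P2_def\<close>)
        \<comment> \<open>\<open>2 * a1 r1 + 2 * a2 r2\<close> is at most the maximum of the doubled
          terms, and nonnegativity of the tail eigenvalues raises their factor from 2 to 4.\<close>
        also have "\<dots> \<le> ereal (max (4 * a1 r1) (4 * a2 r2) + 4 * lam (r1 + 1) + 4 * tau (r2 + 1))"
          using lam[of "r1 + 1"] tau[of "r2 + 1"] by simp
        also have "\<dots> = rhs r1 r2"
        proof -
          have div: "ereal x / ereal y = ereal (x / y)" if "0 < y" for x y :: real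
            using that by simp
          have "C * (real (length xs1))\<^sup>2 * (ln (2 / \<delta>))\<^sup>2 / (lam r1 * real M1) = 4 * a1 r1"
            "C * (real (length xs2))\<^sup>2 * (ln (2 / \<delta>))\<^sup>2 / (tau r2 * real M2) = 4 * a2 r2"
            by (simp_all add: C_def a1_def a2_def)
          then show ?thesis
            unfolding rhs_def div[OF conjunct1[OF True]] div[OF conjunct2[OF True]] by (simp add: max_def)
        qed
        finally show ?thesis .
      qed
      then have "measure_pmf.prob ?q ?S \<ge> 1 - (\<delta> / 2 + \<delta> / 2)"
        by (intro prob_pair_pmf_ge[OF 1 2]) auto
      then show ?thesis by simp
    qed
    then show "let psi1 = functionals L (Db+1) D xs1;
          psi2 = functionals L 1 Db xs2;
          lam = eig_desc (gram K psi1 psi1);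
          tau = eig_desc (gram K psi2 psi2);
          N1 = real (length xs1);
          N2 = real (length xs2)
      in measure_pmf.prob (pair_pmf (uniform_sample M1 xs1) (uniform_sample M2 xs2))
           {(ys1, ys2). \<forall>r1\<in>{1..length psi1}. \<forall>r2\<in>{1..length psi2}.
              approx_error
                (space_Ha K (functionals L (Db+1) D ys1 @ functionals L 1 Db ys2))
                (space_Hb K (psi1 @ psi2))
              \<le> max (ereal (C * N1^2 * (ln (2 / \<delta>))^2) / ereal (lam r1 * real M1))
                     (ereal (C * N2^2 * (ln (2 / \<delta>))^2) / ereal (tau r2 * real M2))
                + ereal (4 * lam (r1 + 1)) + ereal (4 * tau (r2 + 1))}
         \<ge> 1 - \<delta>"
      unfolding Let_def err_def rhs_def lam_def tau_def .
  qed
qed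

end
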